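(* Let $A\in\mathbb{R}^{n\times n}$ be arbitrary. Assume that the infinite-horizon VCS problem $$\text{minimize}_{p}\ -\log\det W_\infty(p)\quad\text{subject to } p\in\Delta,\ W_\infty(p)\succ O$$ admits a unique optimal solution $p_{\mathrm{VCS}}^{\infty}$. For each $T>0$, let $p_{\mathrm{VCS}}^{T}$ be any optimal solution to the finite-horizon VCS problem $$\text{minimize}_{p}\ -\log\det \widetilde W(p;T)\quad\text{subject to } p\in\Delta,\ \widetilde W(p;T)\succ O.$$ Then $p_{\mathrm{VCS}}^{T}\to p_{\mathrm{VCS}}^{\infty}$ as $T\to\infty$.
   Context: Notation: $\Delta=\{p\in\mathbb{R}^n\mid p_i\ge0,\ \sum_ip_i=1\}$; $X\succ O$ means $X$ is Hermitian positive definite; $X^*$ is the conjugate transpose, $X^{-*}=(X^{-1})^*$; $\mathrm{diag}$ of square matrices is the block-diagonal matrix; $I_k$ is the identity and $N_k$ is the $k\times k$ nilpotent Jordan block with ones on the superdiagonal. Blocks of size zero are omitted. $\widetilde W(p;T)=\int_0^T \mathrm{e}^{At}\mathrm{diag}(p)\,\mathrm{e}^{A^\top t}\,\mathrm{d}t$. Jordan form: fix a Jordan decomposition $Q^{-1}AQ=J=\mathrm{diag}(J_1,\dots,J_m)$, $Q\in\mathbb{C}^{n\times n}$ invertible, $J_i=\lambda_iI_{n_i}+N_{n_i}\in\mathbb{C}^{n_i\times n_i}$. Let $m_-,m_0,m_+$ be the numbers of Jordan blocks with $\mathrm{Re}(\lambda_i)<0$, $=0$, $>0$. The blocks are ordered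 so that $\mathrm{Re}(\lambda_i)<0$ for $i\le m_-$, $\mathrm{Re}(\lambda_i)=0$ for $m_-<i\le m_-+m_0$, $\mathrm{Re}(\lambda_i)>0$ for $i>m_-+m_0$, and $\mathrm{Im}(\lambda_{m_-+1})\le\cdots\le\mathrm{Im}(\lambda_{m_-+m_0})$. Let $n_-,n_0,n_+$ be the total sizes of the blocks in the three groups and $J_-,J_0,J_+$ the corresponding diagonal blocks of $J$. Infinite-horizon scaled Gramian: for $p\in\mathbb{R}^n$ put $\widetilde B=Q^{-1}\mathrm{diag}(p)Q^{-*}$, partitioned as $(\widetilde B_{i,j})_{i,j=1}^m$ with $\widetilde B_{i,j}\in\mathbb{C}^{n_i\times n_j}$, and also as $(\widetilde B_{\alpha,\beta})_{\alpha,\beta\in\{-,0,+\}}$ with $\widetilde B_{\alpha,\beta}\in\mathbb{C}^{n_\alpha\times n_\beta}$. Then $W_\infty(p)=\mathrm{diag}(W_-(p),W_0(p),W_+(p))$, where: - $W_-(p)$ and $W_+(p)$ are the unique solutions of $J_-W_-(p)+W_-(p)J_-^*+\widetilde B_{-,-}=O$ and $(-J_+)W_+(p)+W_+(p)(-J_+^* )+\widetilde B_{+,+}=O$. - For $m_-<i,j\le m_-+m_0$, $\widetilde b_{i,j}$ is the $(n_i,n_j)$ (lower-right) entry of $\widetilde B_{i,j}$, and $C_{i,j}\in\mathbb{R}^{n_i\times n_j}$ has $(a,b)$ entry $\frac{1}{(n_i-a)!\,(n_j-b)!\,(n_i-a+n_j-b+1)}$. - $\lambda_1',\dots,\lambda_{m_0'}'$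 are the distinct values among $\lambda_{m_-+1},\dots,\lambda_{m_-+m_0}$, ordered by strictly increasing imaginary part, and $m_0^{(\ell)}$ is the number of Jordan blocks with eigenvalue $\lambda_\ell'$. With $\alpha=m_-+m_0^{(1)}+\cdots+m_0^{(\ell-1)}$ and $\beta=\alpha+m_0^{(\ell)}$, $W_0^{(\ell)}(p)$ is the block matrix $(\widetilde b_{i,j}C_{i,j})_{i,j=\alpha+1}^{\beta}$, and $W_0(p)=\mathrm{diag}(W_0^{(1)}(p),\dots,W_0^{(m_0')}(p))$. *)

theory Defs
  imports
    "HOL-Analysis.Analysis"
    "Jordan_Normal_Form.Spectral_Radius"
begin

hide_const (open) Finite_Cartesian_Product.mat Determinants.det Finite_Cartesian_Product.vec
  Finite_Cartesian_Product.row Finite_Cartesian_Product.column Finite_Cartesian_Product.rows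
  Finite_Cartesian_Product.columns
unbundle no vec_syntax

text \<open>Vectors and matrices are those of \<^theory>\<open>Jordan_Normal_Form.Matrix\<close>, so all indices start at
  0. That library has no topology on matrices: the exponential series and the integral of a
  matrix-valued function are taken entrywise.\<close>

definition prob_simplex :: "nat \<Rightarrow> real vec set" where
  "prob_simplex n = {p \<in> carrier_vec n. (\<forall>i<n. 0 \<le> p $ i) \<and> (\<Sum>i<n. p $ i) = 1}"

text \<open>At type \<^typ>\<open>complex\<close>, \<open>0 < z\<close> means that \<open>z\<close> is real and positive.\<close>

definition pos_definite :: "'a :: conjugatable_ordered_field mat \<Rightarrow> bool" where
  "pos_definite X \<longleftrightarrow> square_mat X \<and> mat_adjoint X = X \<and>
     (\<forall>v \<in> carrier_vec (dim_row X). v \<noteq> 0\<^sub>v (dim_row X) \<longrightarrow> 0 < (X *\<^sub>v v) \<bullet>c v)"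

definition mat_exp :: "real mat \<Rightarrow> real mat" where
  "mat_exp A = mat (dim_row A) (dim_row A) (\<lambda>(i, j). \<Sum>k. (A ^\<^sub>m k) $$ (i, j) / fact k)"

definition gramian :: "real mat \<Rightarrow> real \<Rightarrow> real vec \<Rightarrow> real mat" where
  "gramian A T p = mat (dim_row A) (dim_row A) (\<lambda>ij. integral {0..T} (\<lambda>t.
     (mat_exp (t \<cdot>\<^sub>m A) * mat_diag (dim_row A) (\<lambda>i. p $ i) * mat_exp (t \<cdot>\<^sub>m transpose_mat A)) $$ ij))"

text \<open>A Jordan form is given by three lists of pairs (block size, eigenvalue), holding the blocks
  with negative, zero and positive real part. \<open>Q'\<close> is the inverse of \<open>Q\<close>.\<close>

definition jordan_decomposition ::
  "complex mat \<Rightarrow> complex mat \<Rightarrow> complex mat \<Rightarrow>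
   (nat \<times> complex) list \<Rightarrow> (nat \<times> complex) list \<Rightarrow> (nat \<times> complex) list \<Rightarrow> bool" where
  "jordan_decomposition A Q Q' Jm J0 Jp \<longleftrightarrow>
     similar_mat_wit A (jordan_matrix (Jm @ J0 @ Jp)) Q Q' \<and>
     (\<forall>(k, a) \<in> set (Jm @ J0 @ Jp). k > 0) \<and>
     (\<forall>(k, a) \<in> set Jm. Re a < 0) \<and>
     (\<forall>(k, a) \<in> set J0. Re a = 0) \<and>
     (\<forall>(k, a) \<in> set Jp. Re a > 0) \<and>
     sorted (map (\<lambda>(k, a). Im a) J0)"

definition scaled_input :: "complex mat \<Rightarrow> real vec \<Rightarrow> complex mat" where
  "scaled_input Q' p = Q' * mat_diag (dim_col Q') (\<lambda>i. complex_of_real (p $ i)) * mat_adjoint Q'"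

definition sub_block :: "'a mat \<Rightarrow> nat \<Rightarrow> nat \<Rightarrow> nat \<Rightarrow> nat \<Rightarrow> 'a mat" where
  "sub_block B r k c l = mat k l (\<lambda>(i, j). B $$ (r + i, c + j))"

definition block_start :: "(nat \<times> complex) list \<Rightarrow> nat \<Rightarrow> nat" where
  "block_start js i = sum_list (map fst (take i js))"

definition jordan_sub_block ::
  "(nat \<times> complex) list \<Rightarrow> complex mat \<Rightarrow> nat \<Rightarrow> nat \<Rightarrow> complex mat" where
  "jordan_sub_block js B i j =
     sub_block B (block_start js i) (fst (js ! i)) (block_start js j) (fst (js ! j))"

definition lyapunov_solution :: "complex mat \<Rightarrow> complex mat \<Rightarrow> complex mat" where
  "lyapunov_solution F B = (THE W. W \<in> carrier_mat (dim_row F) (dim_row F) \<and>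
     F * W + W * mat_adjoint F + B = 0\<^sub>m (dim_row F) (dim_row F))"

definition W_minus ::
  "complex mat \<Rightarrow> (nat \<times> complex) list \<Rightarrow> (nat \<times> complex) list \<Rightarrow> (nat \<times> complex) list \<Rightarrow>
   real vec \<Rightarrow> complex mat" where
  "W_minus Q' Jm J0 Jp p =
     (let k = sum_list (map fst Jm)
      in lyapunov_solution (jordan_matrix Jm) (sub_block (scaled_input Q' p) 0 k 0 k))"

definition W_plus ::
  "complex mat \<Rightarrow> (nat \<times> complex) list \<Rightarrow> (nat \<times> complex) list \<Rightarrow> (nat \<times> complex) list \<Rightarrow>
   real vec \<Rightarrow> complex mat" where
  "W_plus Q' Jm J0 Jp p =
     (let r = sum_list (map fst (Jm @ J0)); k = sum_list (map fst Jp)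
      in lyapunov_solution (- jordan_matrix Jp) (sub_block (scaled_input Q' p) r k r k))"

text \<open>The matrices \<open>C\<close> depend only on the two block sizes; with row index \<open>r\<close> from 0,
  the 1-based difference \<open>k - a\<close> becomes \<open>k - 1 - r\<close>.\<close>

definition C_mat :: "nat \<Rightarrow> nat \<Rightarrow> real mat" where
  "C_mat k l = mat k l (\<lambda>(r, c).
     1 / (fact (k - 1 - r) * fact (l - 1 - c) * real ((k - 1 - r) + (l - 1 - c) + 1)))"

definition b_entry :: "(nat \<times> complex) list \<Rightarrow> complex mat \<Rightarrow> nat \<Rightarrow> nat \<Rightarrow> complex" where
  "b_entry js B i j = jordan_sub_block js B i j $$ (fst (js ! i) - 1, fst (js ! j) - 1)"

text \<open>\<open>locate ks r\<close> is the pair of the number of the block containing index \<open>r\<close> and the position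
  of \<open>r\<close> inside that block, for consecutive blocks of sizes \<open>ks\<close>.\<close>

fun locate :: "nat list \<Rightarrow> nat \<Rightarrow> nat \<times> nat" where
  "locate [] r = (0, r)"
| "locate (k # ks) r = (if r < k then (0, r) else let (i, a) = locate ks (r - k) in (Suc i, a))"

definition block_mat :: "nat list \<Rightarrow> (nat \<Rightarrow> nat \<Rightarrow> 'a mat) \<Rightarrow> 'a mat" where
  "block_mat ks F = mat (sum_list ks) (sum_list ks)
     (\<lambda>(r, c). let (i, a) = locate ks r; (j, b) = locate ks c in F i j $$ (a, b))"

text \<open>Imaginary eigenvalues in \<open>J0\<close> are sorted by imaginary part, so that \<^const>\<open>remdups\<close> lists the
  distinct ones by strictly increasing imaginary part, and the blocks of each one are consecutive.\<close>

definition imag_eigenvalues :: "(nat \<times> complex) list \<Rightarrow> complex list" where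
  "imag_eigenvalues J0 = remdups (map snd J0)"

definition imag_multiplicity :: "(nat \<times> complex) list \<Rightarrow> nat \<Rightarrow> nat" where
  "imag_multiplicity J0 l = count_list (map snd J0) (imag_eigenvalues J0 ! l)"

definition W_zero_part ::
  "complex mat \<Rightarrow> (nat \<times> complex) list \<Rightarrow> (nat \<times> complex) list \<Rightarrow> (nat \<times> complex) list \<Rightarrow>
   real vec \<Rightarrow> nat \<Rightarrow> complex mat" where
  "W_zero_part Q' Jm J0 Jp p l =
     (let js = Jm @ J0 @ Jp;
          \<alpha> = length Jm + (\<Sum>l'<l. imag_multiplicity J0 l');
          \<beta> = \<alpha> + imag_multiplicity J0 l
      in block_mat (map (\<lambda>i. fst (js ! i)) [\<alpha>..<\<beta>])
           (\<lambda>i j. b_entry js (scaled_input Q' p) (\<alpha> + i) (\<alpha> + j) \<cdot>\<^sub>m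
              map_mat complex_of_real (C_mat (fst (js ! (\<alpha> + i))) (fst (js ! (\<alpha> + j))))))"

definition W_zero ::
  "complex mat \<Rightarrow> (nat \<times> complex) list \<Rightarrow> (nat \<times> complex) list \<Rightarrow> (nat \<times> complex) list \<Rightarrow>
   real vec \<Rightarrow> complex mat" where
  "W_zero Q' Jm J0 Jp p =
     diag_block_mat (map (W_zero_part Q' Jm J0 Jp p) [0..<length (imag_eigenvalues J0)])"

definition W_inf ::
  "complex mat \<Rightarrow> (nat \<times> complex) list \<Rightarrow> (nat \<times> complex) list \<Rightarrow> (nat \<times> complex) list \<Rightarrow>
   real vec \<Rightarrow> complex mat" where
  "W_inf Q' Jm J0 Jp p =
     diag_block_mat [W_minus Q' Jm J0 Jp p, W_zero Q' Jm J0 Jp p, W_plus Q' Jm J0 Jp p]"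

definition vcs_solution :: "real mat \<Rightarrow> real \<Rightarrow> real vec \<Rightarrow> bool" where
  "vcs_solution A T p \<longleftrightarrow>
     is_arg_min (\<lambda>q. - ln (det (gramian A T q)))
       (\<lambda>q. q \<in> prob_simplex (dim_row A) \<and> pos_definite (gramian A T q)) p"

text \<open>The determinant of a positive definite complex matrix is real, so taking \<^const>\<open>Re\<close>
  only adjusts the type.\<close>

definition vcs_solution_inf ::
  "complex mat \<Rightarrow> (nat \<times> complex) list \<Rightarrow> (nat \<times> complex) list \<Rightarrow> (nat \<times> complex) list \<Rightarrow>
   real vec \<Rightarrow> bool" where
  "vcs_solution_inf Q' Jm J0 Jp p \<longleftrightarrow>
     is_arg_min (\<lambda>q. - ln (Re (det (W_inf Q' Jm J0 Jp q))))
       (\<lambda>q. q \<in> prob_simplex (dim_row Q') \<and> pos_definite (W_inf Q' Jm J0 Jp q)) p"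

end

theory Submission
  imports Defs
begin

text \<open>
  Put \<open>J = Q\<^sup>-\<^sup>1AQ\<close> and \<open>B = Q\<^sup>-\<^sup>1 diag(p) Q\<^sup>-\<^sup>*\<close>. Conjugating the finite-horizon Gramian by \<open>D\<^sub>T Q\<^sup>-\<^sup>1\<close>
  turns it into \<open>\<integral> (D\<^sub>T e\<^bsup>Jt\<^esup>) B (D\<^sub>T e\<^bsup>Jt\<^esup>)\<^sup>*\<close> over \<open>[0, T]\<close>, where \<open>D\<^sub>T\<close> compensates the growth: it is the
  identity on stable blocks, \<open>e\<^bsup>-JT\<^esup>\<close> on unstable blocks, and divides a row at distance \<open>h\<close> from the end
  of an imaginary block by \<open>T\<^bsup>h + 1/2\<^esup>\<close>. This matrix is linear in \<open>p\<close> and its coefficients converge to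
  those of \<open>W\<^sub>\<infinity>(p)\<close>, hence so does its determinant, along any convergent sequence of vectors \<open>p\<close>. The
  conjugation multiplies the determinant by a positive factor that does not depend on \<open>p\<close>, so the
  finite-horizon minimizers are unchanged, every limit point of them maximizes \<open>det W\<^sub>\<infinity>\<close>, and
  compactness of the simplex together with uniqueness gives convergence.
\<close>

section \<open>Block structure of Jordan matrices\<close>

text \<open>The obstacle is that entries of the Gramian grow at different rates, exponentially for
  unstable eigenvalues and like powers of \<open>T\<close> for imaginary ones, so in general no
  scalar normalisation has an invertible limit. The exponent \<open>h + 1/2\<close> arises as
  follows: in a row at height \<open>h\<close> of an imaginary block, the largest entry of
  \<open>e^{Jt}\<close> has order \<open>t^h\<close> and stands in the last column; two such rows
  integrate to order \<open>T^(h + h' + 1)\<close>. The other columns become negligible after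
  scaling, hence only the lower-right entry of each block of \<open>B\<close> survives, and
  \<open>C_mat\<close> collects the constants. Expanding in the entries of \<open>B\<close>
  separates the variables: each entry of the scaled Gramian is a finite sum of products of a factor
  linear in \<open>p\<close> and a kernel depending on \<open>T\<close> alone. Convergence of
  finitely many kernels then covers moving vectors \<open>p\<close> without any uniformity argument.
  Feasibility has to cross the limit in both directions: a nonzero limit determinant makes the
  infinite-horizon optimum feasible for large \<open>T\<close>, and the comparison of determinants
  keeps limit points away from singular matrices.\<close>

lemma fst_locate_less: "r < sum_list ks \<Longrightarrow> fst (locate ks r) < length ks"
  by (induction ks arbitrary: r) (auto simp: split_beta Let_def)

lemma snd_locate_less: "r < sum_list ks \<Longrightarrow> snd (locate ks r) < ks ! fst (locate ks r)"
  by (induction ks arbitrary: r) (auto simp: split_beta Let_def)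

lemma locate_sum: "r < sum_list ks \<Longrightarrow>
    sum_list (take (fst (locate ks r)) ks) + snd (locate ks r) = r"
proof (induction ks arbitrary: r)
  case (Cons k ks)
  show ?case using Cons.prems Cons.IH[of "r - k"] by (auto simp: split_beta Let_def add.assoc)
qed simp

lemma locate_eqI: "i < length ks \<Longrightarrow> a < ks ! i \<Longrightarrow> locate ks (sum_list (take i ks) + a) = (i, a)"
proof (induction ks arbitrary: i)
  case (Cons k ks)
  then show ?case by (cases i) auto
qed simp

lemma locate_append_left: "r < sum_list ks \<Longrightarrow> locate (ks @ ls) r = locate ks r"
  by (induction ks arbitrary: r) (auto simp: split_beta Let_def)

lemma locate_append_right:
  "locate (ks @ ls) (sum_list ks + r) = (length ks + fst (locate ls r), snd (locate ls r))"
  by (induction ks) (auto simp: split_beta Let_def)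

text \<open>\<open>W_zero\<close> nests its blocks twice, Jordan blocks inside eigenvalue groups.
  Flattening only adds the number of blocks in the earlier groups, so both addressings meet in a
  single list of sizes.\<close>

lemma locate_concat:
  assumes "r < sum_list (map sum_list kss)"
  shows "locate (concat kss) r =
    (let (l, r') = locate (map sum_list kss) r; (i, a) = locate (kss ! l) r'
     in (sum_list (take l (map length kss)) + i, a))"
  using assms
proof (induction kss arbitrary: r)
  case (Cons ks kss)
  show ?case
  proof (cases "r < sum_list ks")
    case True
    then show ?thesis by (simp add: locate_append_left split_beta Let_def)
  next
    case False
    then obtain r' where r: "r = sum_list ks + r'" by (metis le_Suc_ex not_less)
    with Cons.prems have "r' < sum_list (map sum_list kss)" by simp
    from Cons.IH[OF this] show ?thesis unfolding r
      by (simp add: locate_append_right split_beta Let_def)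
  qed
qed simp

lemma index_diag_block_mat:
  assumes "\<forall>B \<in> set Bs. square_mat B"
    and "r < sum_list (map dim_row Bs)" and "c < sum_list (map dim_row Bs)"
  shows "diag_block_mat Bs $$ (r, c) =
    (let (i, a) = locate (map dim_row Bs) r; (j, b) = locate (map dim_row Bs) c
     in if i = j then (Bs ! i) $$ (a, b) else 0)"
  using assms
proof (induction Bs arbitrary: r c)
  case (Cons B Bs)
  let ?D = "diag_block_mat Bs"
  have sq: "dim_col B = dim_row B" "dim_col ?D = dim_row ?D" "dim_row ?D = sum_list (map dim_row Bs)"
    using Cons.prems(1) diag_block_mat_square[of Bs] by (auto simp: dim_diag_block_mat)
  have IH: "?D $$ (r - dim_row B, c - dim_row B) =
    (let (i, a) = locate (map dim_row Bs) (r - dim_row B); (j, b) = locate (map dim_row Bs) (c - dim_row B)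
     in if i = j then (Bs ! i) $$ (a, b) else 0)" if "\<not> r < dim_row B" "\<not> c < dim_row B"
    using Cons.prems that by (intro Cons.IH) auto
  show ?case using Cons.prems sq IH
    by (auto simp: index_mat_four_block Let_def split_beta)
qed simp

definition block_no :: "(nat \<times> complex) list \<Rightarrow> nat \<Rightarrow> nat" where
  "block_no js r = fst (locate (map fst js) r)"

definition eig :: "(nat \<times> complex) list \<Rightarrow> nat \<Rightarrow> complex" where
  "eig js r = snd (js ! block_no js r)"

text \<open>The distance of an index to the last index of its block.\<close>

definition height :: "(nat \<times> complex) list \<Rightarrow> nat \<Rightarrow> nat" where
  "height js r = fst (js ! block_no js r) - 1 - snd (locate (map fst js) r)"

abbreviation size_of :: "(nat \<times> complex) list \<Rightarrow> nat" where
  "size_of js \<equiv> sum_list (map fst js)"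

lemma block_no_less: "r < size_of js \<Longrightarrow> block_no js r < length js"
  using fst_locate_less[of r "map fst js"] by (simp add: block_no_def)

text \<open>A block occupies consecutive indices. This confines the intermediate index of a product
  of exponentials, and the neighbours of an index in the Lyapunov recursion, to the block at
  hand.\<close>

lemma block_no_between:
  assumes "r \<le> s" "s \<le> c" "c < size_of js" "block_no js r = block_no js c"
  shows "block_no js s = block_no js r"
proof -
  let ?ks = "map fst js" and ?i = "block_no js r"
  have r: "sum_list (take ?i ?ks) + snd (locate ?ks r) = r"
    using locate_sum[of r ?ks] assms by (simp add: block_no_def)
  have c: "sum_list (take ?i ?ks) + snd (locate ?ks c) = c" "snd (locate ?ks c) < ?ks ! ?i"
    using locate_sum[of c ?ks] snd_locate_less[of c ?ks] assms by (simp_all add: block_no_def)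
  define a where "a = s - sum_list (take ?i ?ks)"
  have s: "s = sum_list (take ?i ?ks) + a" "a < ?ks ! ?i" using assms r c by (auto simp: a_def)
  have "?i < length ?ks" using block_no_less[of r js] assms by simp
  from locate_eqI[OF this s(2)] have "locate ?ks s = (?i, a)" by (simp only: s(1)[symmetric])
  then show ?thesis by (simp add: block_no_def)
qed

lemma eig_cong: "block_no js r = block_no js s \<Longrightarrow> eig js r = eig js s"
  by (simp add: eig_def)

lemma height_diff:
  assumes "c < size_of js" "block_no js r = block_no js c" "r \<le> c"
  shows "height js r = height js c + (c - r)"
proof -
  let ?ks = "map fst js" and ?i = "block_no js r"
  have r: "sum_list (take ?i ?ks) + snd (locate ?ks r) = r"
    using locate_sum[of r ?ks] assms by (simp add: block_no_def)
  have c: "sum_list (take ?i ?ks) + snd (locate ?ks c) = c" "snd (locate ?ks c) < ?ks ! ?i"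
    using locate_sum[of c ?ks] snd_locate_less[of c ?ks] assms by (simp_all add: block_no_def)
  have "?ks ! ?i = fst (js ! ?i)" using block_no_less[of r js] assms by simp
  with r c assms show ?thesis by (auto simp: height_def)
qed

lemma index_jordan_matrix:
  assumes "r < size_of js" "c < size_of js"
  shows "jordan_matrix js $$ (r, c) =
    (if r = c then eig js r else if c = Suc r \<and> block_no js r = block_no js c then 1 else 0)"
proof -
  let ?Bs = "map (\<lambda>(k, a). jordan_block k a) js" and ?ks = "map fst js"
  have d: "map dim_row ?Bs = ?ks" by (auto simp: jordan_block_def)
  have "jordan_matrix js $$ (r, c) = (if block_no js r = block_no js c
      then (?Bs ! block_no js r) $$ (snd (locate ?ks r), snd (locate ?ks c)) else 0)"
    unfolding jordan_matrix_def using assms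
    by (subst index_diag_block_mat, unfold d)
       (auto simp: split_beta Let_def block_no_def)
  also have "\<dots> = (if r = c then eig js r else if c = Suc r \<and> block_no js r = block_no js c then 1 else 0)"
  proof (cases "block_no js r = block_no js c")
    case True
    let ?i = "block_no js r"
    have i: "?i < length js" using assms by (simp add: block_no_less)
    have r: "sum_list (take ?i ?ks) + snd (locate ?ks r) = r" "snd (locate ?ks r) < fst (js ! ?i)"
      using locate_sum[of r ?ks] snd_locate_less[of r ?ks] assms i by (simp_all add: block_no_def)
    have c: "sum_list (take ?i ?ks) + snd (locate ?ks c) = c" "snd (locate ?ks c) < fst (js ! ?i)"
      using locate_sum[of c ?ks] snd_locate_less[of c ?ks] assms True i by (simp_all add: block_no_def)
    have e: "snd (locate ?ks r) = snd (locate ?ks c) \<longleftrightarrow> r = c"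
      "Suc (snd (locate ?ks r)) = snd (locate ?ks c) \<longleftrightarrow> c = Suc r" using r c by linarith+
    show ?thesis using True i r(2) c(2) e by (simp add: split_beta eig_def)
  qed auto
  finally show ?thesis .
qed

lemma block_no_append:
  "r < size_of js \<Longrightarrow> block_no (js @ ks) r = block_no js r"
  "block_no (js @ ks) (size_of js + r) = length js + block_no ks r"
  by (simp_all add: block_no_def locate_append_left locate_append_right[of "map fst js", simplified])

lemma eig_append:
  "r < size_of js \<Longrightarrow> eig (js @ ks) r = eig js r"
  "eig (js @ ks) (size_of js + r) = eig ks r"
  by (simp_all add: eig_def block_no_append nth_append block_no_less)

lemma height_append:
  "r < size_of js \<Longrightarrow> height (js @ ks) r = height js r"
  "height (js @ ks) (size_of js + r) = height ks r"
  by (simp_all add: height_def block_no_append nth_append block_no_less locate_append_left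
      locate_append_right[of "map fst js", simplified])

lemma eig_mem: "r < size_of js \<Longrightarrow> \<exists>k. (k, eig js r) \<in> set js"
  unfolding eig_def by (metis block_no_less nth_mem prod.collapse)

section \<open>The matrix exponential in Jordan form\<close>

text \<open>The entries of \<open>e\<^bsup>Jt\<^esup>\<close>.\<close>

definition jexp :: "(nat \<times> complex) list \<Rightarrow> real \<Rightarrow> nat \<Rightarrow> nat \<Rightarrow> complex" where
  "jexp js t r c = (if block_no js r = block_no js c \<and> r \<le> c
     then exp (of_real t * eig js r) * of_real t ^ (c - r) / fact (c - r) else 0)"

text \<open>Induction with Pascal's rule: column \<open>c\<close> of \<open>J\<close> has nonzero
  entries at most in rows \<open>c\<close> and \<open>c - 1\<close>.\<close>

lemma index_jordan_matrix_pow: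
  assumes "r < size_of js" "c < size_of js"
  shows "(jordan_matrix js ^\<^sub>m k) $$ (r, c) = (if block_no js r = block_no js c \<and> r \<le> c
     then of_nat (k choose (c - r)) * eig js r ^ (k - (c - r)) else 0)"
  using assms
proof (induction k arbitrary: c)
  case 0
  then show ?case by (auto simp: not_le)
next
  case (Suc k)
  let ?N = "size_of js" and ?J = "jordan_matrix js"
  let ?X = "\<lambda>r c. if block_no js r = block_no js c \<and> r \<le> c
     then of_nat (k choose (c - r)) * eig js r ^ (k - (c - r)) else 0"
  have car: "?J ^\<^sub>m k \<in> carrier_mat ?N ?N" by (rule pow_carrier_mat) simp
  have "(?J ^\<^sub>m Suc k) $$ (r, c) = (\<Sum>s<?N. (?J ^\<^sub>m k) $$ (r, s) * ?J $$ (s, c))"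
    using Suc.prems car by (simp add: scalar_prod_def lessThan_atLeast0)
  also have "\<dots> = (\<Sum>s<?N. (if s = c then ?X r c * eig js c else 0)
      + (if Suc s = c \<and> block_no js s = block_no js c then ?X r s else 0))"
    using Suc by (intro sum.cong) (auto simp: index_jordan_matrix)
  also have "\<dots> = ?X r c * eig js c
      + (\<Sum>s<?N. if Suc s = c \<and> block_no js s = block_no js c then ?X r s else 0)"
    using Suc.prems by (simp add: sum.distrib)
  also have "(\<Sum>s<?N. if Suc s = c \<and> block_no js s = block_no js c then ?X r s else 0)
      = (\<Sum>s<?N. if s = c - 1 then (if 0 < c \<and> block_no js (c - 1) = block_no js c then ?X r (c - 1) else 0) else 0)"
    by (intro sum.cong) auto
  also have "\<dots> = (if 0 < c \<and> block_no js (c - 1) = block_no js c then ?X r (c - 1) else 0)"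
    using Suc.prems by (subst sum.delta) auto
  also have "?X r c * eig js c + \<dots> = (if block_no js r = block_no js c \<and> r \<le> c
     then of_nat (Suc k choose (c - r)) * eig js r ^ (Suc k - (c - r)) else 0)"
  proof (cases "block_no js r = block_no js c \<and> r \<le> c")
    case True
    then have e: "eig js c = eig js r" using eig_cong by metis
    show ?thesis
    proof (cases "r = c")
      case True
      then show ?thesis by auto
    next
      case False
      then obtain d where d: "c = Suc (r + d)" using True by (metis less_iff_Suc_add le_neq_implies_less)
      have b: "block_no js (r + d) = block_no js r"
        using block_no_between[of r "r + d" c js] True Suc.prems d by auto
      \<comment> \<open>For \<open>k < Suc d\<close> the subtraction truncates, but then both sides
        vanish with the binomial coefficient.\<close>
      have p: "of_nat (k choose Suc d) * eig js r ^ (k - Suc d) * eig js r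
          = of_nat (k choose Suc d) * eig js r ^ (k - d)"
      proof (cases "Suc d \<le> k")
        case True
        then have "k - d = Suc (k - Suc d)" by simp
        then show ?thesis by simp
      qed simp
      show ?thesis using True b d e p by (simp add: algebra_simps)
    qed
  qed auto
  finally show ?case .
qed

text \<open>The terms with \<open>k < c - r\<close> vanish. After a shift by
  \<open>d = c - r\<close>, the identity \<open>(i + d choose d) / (i + d)! = 1 / (d! i!)\<close>
  leaves a multiple of the scalar exponential series.\<close>

lemma jexp_sums:
  assumes "r < size_of js" "c < size_of js"
  shows "(\<lambda>k. of_real t ^ k * (jordan_matrix js ^\<^sub>m k) $$ (r, c) / fact k) sums jexp js t r c"
proof (cases "block_no js r = block_no js c \<and> r \<le> c")
  case True
  let ?d = "c - r" and ?m = "eig js r"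
  let ?f = "\<lambda>k. of_real t ^ k * (of_nat (k choose ?d) * ?m ^ (k - ?d)) / fact k :: complex"
  have eq: "?f (i + ?d) = (of_real t ^ ?d / fact ?d) * ((of_real t * ?m) ^ i /\<^sub>R fact i)" for i
  proof -
    have "of_nat (i + ?d choose ?d) = (fact (i + ?d) / (fact ?d * fact i) :: complex)"
      by (subst binomial_fact) auto
    then show ?thesis by (simp add: scaleR_conv_of_real field_simps power_add)
  qed
  have "(\<lambda>i. ?f (i + ?d)) sums (of_real t ^ ?d / fact ?d * exp (of_real t * ?m))"
    unfolding eq by (intro sums_mult exp_converges)
  then have "?f sums (of_real t ^ ?d / fact ?d * exp (of_real t * ?m))"
    by (subst (asm) sums_zero_iff_shift) auto
  with True show ?thesis
    unfolding index_jordan_matrix_pow[OF assms] by (simp add: jexp_def mult_ac)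
qed (auto simp: index_jordan_matrix_pow[OF assms] jexp_def)

text \<open>The semigroup law \<open>e^{Ja} e^{Jb} = e^{J(a+b)}\<close>: only
  \<open>r \<le> s \<le> c\<close> within one block contributes, and the sum is a binomial
  expansion. With \<open>a = - T\<close> it turns the unstable scaling into a time shift.\<close>

lemma jexp_add:
  assumes "r < size_of js" "c < size_of js"
  shows "(\<Sum>s<size_of js. jexp js a r s * jexp js b s c) = jexp js (a + b) r c"
proof (cases "block_no js r = block_no js c \<and> r \<le> c")
  case True
  let ?d = "c - r" and ?m = "eig js r" and ?N = "size_of js"
  have *: "jexp js a r (r + k) * jexp js b (r + k) c =
      exp (of_real (a + b) * ?m) / fact ?d * (of_nat (?d choose k) * of_real a ^ k * of_real b ^ (?d - k))"
    if "k \<le> ?d" for k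
  proof -
    have bl: "block_no js (r + k) = block_no js r"
      using block_no_between[of r "r + k" c js] True that assms by auto
    then have e: "eig js (r + k) = ?m" by (rule eig_cong)
    have "c - (r + k) = ?d - k" by simp
    moreover have "of_nat (?d choose k) = (fact ?d / (fact k * fact (?d - k)) :: complex)"
      using that by (subst binomial_fact) auto
    moreover have "r + k \<le> c" using that conjunct2[OF True] by arith
    moreover have "exp (of_real a * ?m) * exp (of_real b * ?m) = exp (of_real (a + b) * ?m)"
      by (simp add: exp_add ring_distribs)
    ultimately show ?thesis using True bl e
      by (simp add: jexp_def)
  qed
  have "(\<Sum>s<?N. jexp js a r s * jexp js b s c) = (\<Sum>s\<in>{r..c}. jexp js a r s * jexp js b s c)"
    using assms by (intro sum.mono_neutral_right) (auto simp: jexp_def)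
  also have "\<dots> = (\<Sum>k\<le>?d. jexp js a r (r + k) * jexp js b (r + k) c)"
    using True by (intro sum.reindex_bij_witness[of _ "\<lambda>k. r + k" "\<lambda>s. s - r"]) auto
  also have "\<dots> = exp (of_real (a + b) * ?m) / fact ?d * (of_real a + of_real b) ^ ?d"
    unfolding binomial_ring sum_distrib_left by (intro sum.cong refl *) simp
  finally show ?thesis using True by (simp add: jexp_def)
next
  case False
  then have "jexp js a r s * jexp js b s c = 0" for s by (auto simp: jexp_def)
  then have "(\<Sum>s<size_of js. jexp js a r s * jexp js b s c) = 0" by simp
  moreover have "jexp js (a + b) r c = 0" using False by (auto simp: jexp_def)
  ultimately show ?thesis by simp
qed

lemma continuous_jexp: "continuous_on S (\<lambda>t. jexp js t r c)"
  by (cases "block_no js r = block_no js c \<and> r \<le> c")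
     (auto simp: jexp_def intro!: continuous_intros)

section \<open>The real matrix exponential in Jordan coordinates\<close>

lemma smult_pow_mat:
  assumes "A \<in> carrier_mat n n"
  shows "(t \<cdot>\<^sub>m A) ^\<^sub>m k = (t ^ k :: 'a :: comm_semiring_1) \<cdot>\<^sub>m (A ^\<^sub>m k)"
proof (induction k)
  case 0
  then show ?case by (intro eq_matI) auto
next
  case (Suc k)
  have c: "A ^\<^sub>m k \<in> carrier_mat n n" using assms by (rule pow_carrier_mat)
  have "(t \<cdot>\<^sub>m A) ^\<^sub>m Suc k = (t ^ k \<cdot>\<^sub>m A ^\<^sub>m k) * (t \<cdot>\<^sub>m A)" using Suc by simp
  also have "\<dots> = t ^ Suc k \<cdot>\<^sub>m (A ^\<^sub>m k * A)"
    using c assms by (intro eq_matI) (auto simp: mult_ac)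
  finally show ?case by simp
qed

lemma transpose_pow_mat:
  assumes "A \<in> carrier_mat n n"
  shows "transpose_mat A ^\<^sub>m k = transpose_mat (A ^\<^sub>m k :: 'a :: comm_semiring_1 mat)"
proof (induction k)
  case (Suc k)
  have c: "A ^\<^sub>m k \<in> carrier_mat n n" "transpose_mat A \<in> carrier_mat n n" using assms by auto
  have "A ^\<^sub>m Suc k = A * A ^\<^sub>m k"
  proof (induction k)
    case (Suc k)
    have "A ^\<^sub>m k \<in> carrier_mat n n" using assms by (rule pow_carrier_mat)
    from assoc_mult_mat[OF assms this assms] Suc show ?case by simp
  qed (use assms in auto)
  then have "transpose_mat (A ^\<^sub>m Suc k) = transpose_mat (A ^\<^sub>m k) * transpose_mat A"
    using transpose_mult[OF assms c(1)] by simp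
  then show ?case using Suc by simp
qed (use assms in auto)

lemma mat_exp_transpose:
  assumes "A \<in> carrier_mat n n"
  shows "mat_exp (t \<cdot>\<^sub>m transpose_mat A) = transpose_mat (mat_exp (t \<cdot>\<^sub>m A))"
proof -
  have "(t \<cdot>\<^sub>m transpose_mat A) ^\<^sub>m k = transpose_mat ((t \<cdot>\<^sub>m A) ^\<^sub>m k)" for k
  proof -
    have "t \<cdot>\<^sub>m transpose_mat A = transpose_mat (t \<cdot>\<^sub>m A)" by (intro eq_matI) auto
    then show ?thesis using assms transpose_pow_mat[of "t \<cdot>\<^sub>m A" n k] by simp
  qed
  moreover have "(t \<cdot>\<^sub>m A) ^\<^sub>m k \<in> carrier_mat n n" for k using assms by (intro pow_carrier_mat) auto
  ultimately show ?thesis using assms by (intro eq_matI) (auto simp: mat_exp_def)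
qed

lemma index_mult3_mat:
  assumes "X \<in> carrier_mat n n" "Y \<in> carrier_mat n n" "Z \<in> carrier_mat n n" "i < n" "j < n"
  shows "(X * Y * Z) $$ (i, j) = (\<Sum>c<n. \<Sum>r<n. X $$ (i, r) * Y $$ (r, c) * Z $$ (c, j))"
proof -
  have "(X * Y * Z) $$ (i, j) = (\<Sum>c<n. (X * Y) $$ (i, c) * Z $$ (c, j))"
    using assms by (subst index_mult_mat(1)) (auto simp: scalar_prod_def lessThan_atLeast0)
  also have "\<dots> = (\<Sum>c<n. \<Sum>r<n. X $$ (i, r) * Y $$ (r, c) * Z $$ (c, j))"
    using assms by (intro sum.cong) (auto simp: scalar_prod_def lessThan_atLeast0 sum_distrib_right)
  finally show ?thesis .
qed

lemma mat_exp_jordan: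
  assumes A: "A \<in> carrier_mat n n"
    and sim: "similar_mat_wit (map_mat complex_of_real A) (jordan_matrix js) Q Q'"
    and ij: "i < n" "j < n"
  shows "complex_of_real (mat_exp (t \<cdot>\<^sub>m A) $$ (i, j)) =
    (\<Sum>c<n. \<Sum>r<n. Q $$ (i, r) * jexp js t r c * Q' $$ (c, j))"
proof -
  let ?J = "jordan_matrix js"
  from sim A have car: "?J \<in> carrier_mat n n" "Q \<in> carrier_mat n n" "Q' \<in> carrier_mat n n"
    by (auto simp: similar_mat_wit_def Let_def)
  then have N: "size_of js = n" by auto
  have Jk: "?J ^\<^sub>m k \<in> carrier_mat n n" for k using car by (intro pow_carrier_mat) auto
  have Ak: "A ^\<^sub>m k \<in> carrier_mat n n" for k using A by (intro pow_carrier_mat) auto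
  have eq: "complex_of_real (((t \<cdot>\<^sub>m A) ^\<^sub>m k) $$ (i, j) / fact k) =
     (\<Sum>c<n. \<Sum>r<n. Q $$ (i, r) * (of_real t ^ k * (?J ^\<^sub>m k) $$ (r, c) / fact k) * Q' $$ (c, j))" for k
  proof -
    have "map_mat complex_of_real (A ^\<^sub>m k) = map_mat complex_of_real A ^\<^sub>m k"
      using A by (rule of_real_hom.mat_hom_pow)
    also have "\<dots> = Q * ?J ^\<^sub>m k * Q'"
      using similar_mat_wit_pow_id[OF sim] by simp
    finally have "complex_of_real ((A ^\<^sub>m k) $$ (i, j)) = (Q * ?J ^\<^sub>m k * Q') $$ (i, j)"
      using Ak[of k] ij by (metis carrier_matD index_map_mat(1))
    also have "\<dots> = (\<Sum>c<n. \<Sum>r<n. Q $$ (i, r) * (?J ^\<^sub>m k) $$ (r, c) * Q' $$ (c, j))"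
      using car Jk ij by (intro index_mult3_mat)
    finally show ?thesis using carrier_matD[OF Ak[of k]] ij
      by (simp add: smult_pow_mat[OF A] sum_distrib_left sum_divide_distrib mult_ac)
  qed
  have "(\<lambda>k. complex_of_real (((t \<cdot>\<^sub>m A) ^\<^sub>m k) $$ (i, j) / fact k)) sums
     (\<Sum>c<n. \<Sum>r<n. Q $$ (i, r) * jexp js t r c * Q' $$ (c, j))" (is "?f sums ?S")
    unfolding eq by (intro sums_sum sums_mult sums_mult2 jexp_sums) (auto simp: N)
  then have f: "?f sums ?S" .
  \<comment> \<open>Summability of the real series is inherited from its complex image, which makes
    the real \<open>suminf\<close> meaningful.\<close>
  from sums_summable[OF f] have s: "summable (\<lambda>k. ((t \<cdot>\<^sub>m A) ^\<^sub>m k) $$ (i, j) / fact k)"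
    by (simp only: summable_of_real_iff)
  from suminf_of_real[OF s, where 'a = complex] sums_unique[OF f]
  have "complex_of_real (\<Sum>k. ((t \<cdot>\<^sub>m A) ^\<^sub>m k) $$ (i, j) / fact k) = ?S" by simp
  then show ?thesis using A ij by (simp add: mat_exp_def)
qed

section \<open>Limits of exponential moments\<close>

text \<open>A Laplace transform of \<open>t ^ m\<close> truncated at \<open>T\<close>. In the kernel
  integrals \<open>t ^ m\<close> comes from the nilpotent parts and \<open>z\<close> from a pair of
  eigenvalues.\<close>

definition exp_moment :: "nat \<Rightarrow> complex \<Rightarrow> real \<Rightarrow> complex" where
  "exp_moment m z T = integral {0..T} (\<lambda>t. of_real t ^ m * exp (- z * of_real t))"

text \<open>Integration by parts. The term \<open>0 ^ m\<close> is the boundary value at 0, equal to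
  1 exactly for \<open>m = 0\<close>; there \<open>m - 1\<close> truncates, but its factor is
  0.\<close>

lemma exp_moment_rec:
  assumes "z \<noteq> 0" "0 \<le> T"
  shows "exp_moment m z T =
    (of_nat m * exp_moment (m - 1) z T + 0 ^ m - of_real T ^ m * exp (- z * of_real T)) / z"
proof -
  let ?f = "\<lambda>m t. of_real t ^ m * exp (- z * of_real t) :: complex"
  have int: "?f m integrable_on {0..T}" for m
    by (intro integrable_continuous_interval continuous_intros)
  have "((\<lambda>t. of_nat m * ?f (m - 1) t - z * ?f m t) has_integral (?f m T - ?f m 0)) {0..T}"
  proof (rule fundamental_theorem_of_calculus[OF assms(2)])
    fix t :: real
    have "((\<lambda>w. w ^ m * exp (- z * w)) has_field_derivative
       (of_nat m * (w ^ (m - 1) * exp (- z * w)) - z * (w ^ m * exp (- z * w)))) (at w)" for w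
      by (auto intro!: derivative_eq_intros simp: algebra_simps)
    from has_vector_derivative_real_field[OF this[of "of_real t"]]
    show "(?f m has_vector_derivative of_nat m * ?f (m - 1) t - z * ?f m t) (at t within {0..T})"
      by (rule has_vector_derivative_at_within)
  qed
  then have "integral {0..T} (\<lambda>t. of_nat m * ?f (m - 1) t - z * ?f m t) = ?f m T - ?f m 0"
    by (rule integral_unique)
  moreover have "integral {0..T} (\<lambda>t. of_nat m * ?f (m - 1) t - z * ?f m t) =
     of_nat m * exp_moment (m - 1) z T - z * exp_moment m z T"
    using int by (subst Henstock_Kurzweil_Integration.integral_diff)
      (auto simp: exp_moment_def intro!: integrable_on_mult_right)
  ultimately show ?thesis using assms by (cases m) (auto simp: field_simps)
qed

lemma exp_moment_zero:
  "z \<noteq> 0 \<Longrightarrow> 0 \<le> T \<Longrightarrow> exp_moment 0 z T = (1 - exp (- z * of_real T)) / z"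
  by (subst exp_moment_rec) auto

lemma exp_moment_Suc:
  "z \<noteq> 0 \<Longrightarrow> 0 \<le> T \<Longrightarrow> exp_moment (Suc m) z T =
    (of_nat (Suc m) * exp_moment m z T - of_real T ^ Suc m * exp (- z * of_real T)) / z"
  by (subst exp_moment_rec) auto

lemma tendsto_power_exp_0:
  assumes "0 < Re z"
  shows "((\<lambda>T. of_real T ^ m * exp (- z * of_real T)) \<longlongrightarrow> 0) at_top"
proof (rule tendsto_norm_zero_cancel)
  let ?a = "Re z"
  have "((\<lambda>T. (1 / ?a ^ m) * ((?a * T) ^ m / exp (?a * T))) \<longlongrightarrow> 1 / ?a ^ m * 0) at_top"
    using assms by (intro tendsto_mult tendsto_const filterlim_compose[OF tendsto_power_div_exp_0]
      filterlim_tendsto_pos_mult_at_top[OF tendsto_const] filterlim_ident)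
  then have "((\<lambda>T. T ^ m * exp (- (?a * T))) \<longlongrightarrow> 0) at_top"
    using assms by (simp add: power_mult_distrib exp_minus field_simps)
  moreover have "eventually (\<lambda>T. T ^ m * exp (- (?a * T)) = norm (of_real T ^ m * exp (- z * of_real T))) at_top"
    using eventually_ge_at_top[of 0]
    by eventually_elim (simp add: norm_mult norm_power norm_exp_eq_Re)
  ultimately show "((\<lambda>T. norm (of_real T ^ m * exp (- z * of_real T))) \<longlongrightarrow> 0) at_top"
    by (rule Lim_transform_eventually)
qed

lemma exp_moment_lim:
  assumes "0 < Re z"
  shows "(exp_moment m z \<longlongrightarrow> fact m / z ^ Suc m) at_top"
proof (induction m)
  have z: "z \<noteq> 0" using assms by auto
  case 0
  have lim: "((\<lambda>T. (1 - of_real T ^ 0 * exp (- z * of_real T)) / z) \<longlongrightarrow> (1 - 0) / z) at_top"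
    by (intro tendsto_intros tendsto_power_exp_0 assms z)
  have ev: "eventually (\<lambda>T. (1 - of_real T ^ 0 * exp (- z * of_real T)) / z = exp_moment 0 z T) at_top"
    using eventually_ge_at_top[of 0] by eventually_elim (simp add: exp_moment_zero[OF z])
  from Lim_transform_eventually[OF lim ev] show ?case by simp
next
  case (Suc m)
  have z: "z \<noteq> 0" using assms by auto
  have lim: "((\<lambda>T. (of_nat (Suc m) * exp_moment m z T - of_real T ^ Suc m * exp (- z * of_real T)) / z)
     \<longlongrightarrow> (of_nat (Suc m) * (fact m / z ^ Suc m) - 0) / z) at_top"
    by (intro tendsto_intros tendsto_power_exp_0 assms z Suc.IH)
  have ev: "eventually (\<lambda>T. (of_nat (Suc m) * exp_moment m z T
      - of_real T ^ Suc m * exp (- z * of_real T)) / z = exp_moment (Suc m) z T) at_top"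
    using eventually_ge_at_top[of 0] by eventually_elim (simp add: exp_moment_Suc[OF z])
  from Lim_transform_eventually[OF lim ev] show ?case by (simp add: mult_ac)
qed

lemma inverse_of_real_tendsto_0: "((\<lambda>T. inverse (of_real T) :: complex) \<longlongrightarrow> 0) at_top"
  using tendsto_of_real[OF tendsto_inverse_0_at_top[OF filterlim_ident], where 'a = complex] by simp

text \<open>The exponential has modulus 1, so integration by parts keeps the moment one power of
  \<open>T\<close> below its order for \<open>z = 0\<close>. This is why distinct imaginary
  eigenvalues decouple in the limit.\<close>

lemma exp_moment_oscillating:
  assumes "Re z = 0" "z \<noteq> 0"
  shows "((\<lambda>T. exp_moment m z T / of_real T ^ Suc m) \<longlongrightarrow> 0) at_top"
proof -
  have e: "((\<lambda>T. exp (- z * of_real T) * inverse (of_real T)) \<longlongrightarrow> 0) at_top"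
  proof (rule tendsto_norm_zero_cancel)
    show "((\<lambda>T. norm (exp (- z * of_real T) * inverse (of_real T))) \<longlongrightarrow> 0) at_top"
      using tendsto_norm_zero[OF inverse_of_real_tendsto_0] assms
      by (simp add: norm_mult norm_exp_eq_Re)
  qed
  show ?thesis
  proof (induction m)
    case 0
    have lim: "((\<lambda>T. (inverse (of_real T) - exp (- z * of_real T) * inverse (of_real T)) / z) \<longlongrightarrow> (0 - 0) / z) at_top"
      by (intro tendsto_intros e inverse_of_real_tendsto_0 assms)
    have ev: "eventually (\<lambda>T. (inverse (of_real T) - exp (- z * of_real T) * inverse (of_real T)) / z
        = exp_moment 0 z T / of_real T ^ Suc 0) at_top"
      using eventually_gt_at_top[of 0]
      by eventually_elim (simp add: exp_moment_zero[OF assms(2)] field_simps)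
    from Lim_transform_eventually[OF lim ev] show ?case by simp
  next
    case (Suc m)
    have lim: "((\<lambda>T. (of_nat (Suc m) * (exp_moment m z T / of_real T ^ Suc m) * inverse (of_real T)
        - exp (- z * of_real T) * inverse (of_real T)) / z) \<longlongrightarrow> (of_nat (Suc m) * 0 * 0 - 0) / z) at_top"
      by (intro tendsto_intros e inverse_of_real_tendsto_0 assms Suc)
    have ev: "eventually (\<lambda>T. (of_nat (Suc m) * (exp_moment m z T / of_real T ^ Suc m) * inverse (of_real T)
        - exp (- z * of_real T) * inverse (of_real T)) / z
        = exp_moment (Suc m) z T / of_real T ^ Suc (Suc m)) at_top"
      using eventually_gt_at_top[of 0]
    proof eventually_elim
      case (elim T)
      then have "complex_of_real T \<noteq> 0" "0 \<le> T" by auto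
      then show ?case by (simp add: exp_moment_Suc[OF assms(2)] divide_simps)
    qed
    from Lim_transform_eventually[OF lim ev] show ?case by simp
  qed
qed

text \<open>The origin of the third factor in the denominator of \<open>C_mat\<close>: without
  oscillation the moment has exact order \<open>m + 1\<close>.\<close>

lemma exp_moment_0: "0 \<le> T \<Longrightarrow> exp_moment m 0 T = of_real T ^ Suc m / of_nat (Suc m)"
proof -
  assume T: "0 \<le> T"
  have "((\<lambda>t. of_real t ^ m :: complex) has_integral
     (of_real T ^ Suc m / of_nat (Suc m) - of_real 0 ^ Suc m / of_nat (Suc m))) {0..T}"
  proof (rule fundamental_theorem_of_calculus[OF T])
    fix t :: real
    have "((\<lambda>w. w ^ Suc m / of_nat (Suc m)) has_field_derivative w ^ m) (at w)" for w :: complex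
      using DERIV_cdivide[OF DERIV_power_Suc[OF DERIV_ident[of "at w"], of m], of "of_nat (Suc m)"]
        of_nat_neq_0[of m, where 'a = complex] by simp
    from has_vector_derivative_real_field[OF this[of "of_real t"]]
    show "((\<lambda>t. of_real t ^ Suc m / of_nat (Suc m) :: complex) has_vector_derivative of_real t ^ m) (at t within {0..T})"
      by (rule has_vector_derivative_at_within)
  qed
  then show ?thesis by (simp add: exp_moment_def integral_unique)
qed

text \<open>Time reversal, used for unstable blocks: there \<open>e^{J(t-T)}\<close> decays away
  from \<open>T\<close>, and after the flip it decays away from 0.\<close>

lemma integral_flip:
  fixes f :: "real \<Rightarrow> 'a :: euclidean_space"
  shows "integral {0..T} (\<lambda>t. f (T - t)) = integral {0..T} f"
proof -
  have "integral {0..T} (\<lambda>t. f (T - t)) = integral {- T..0} (\<lambda>x. f (- x))"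
    using integral_shift_Icc_real[of 0 T "\<lambda>x. f (- x)" "- T"] by (simp add: o_def)
  also have "\<dots> = integral {0..T} f"
    using Henstock_Kurzweil_Integration.integral_reflect_real[of T 0 f] by simp
  finally show ?thesis .
qed

text \<open>Entries of \<open>D\<^sub>T e\<^bsup>Jt\<^esup>\<close>, where the block-diagonal scaling \<open>D\<^sub>T\<close> is the identity on the stable part,
  \<open>e\<^bsup>- J T\<^esup>\<close> on the unstable part, and diagonal with powers of \<open>T\<close> on the imaginary part.\<close>

definition scaled_jexp :: "(nat \<times> complex) list \<Rightarrow> real \<Rightarrow> real \<Rightarrow> nat \<Rightarrow> nat \<Rightarrow> complex" where
  "scaled_jexp js T t r c =
     (if Re (eig js r) < 0 then jexp js t r c
      else if Re (eig js r) = 0 then jexp js t r c / of_real (T ^ height js r * sqrt T)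
      else jexp js (t - T) r c)"

text \<open>The coefficient of entry \<open>(u, v)\<close> of \<open>scaled_input\<close> in entry
  \<open>(r, c)\<close> of the scaled Gramian. It does not involve \<open>p\<close>, so the limit
  reduces to finitely many scalar functions of \<open>T\<close>.\<close>

definition scaled_kernel :: "(nat \<times> complex) list \<Rightarrow> real \<Rightarrow> nat \<Rightarrow> nat \<Rightarrow> nat \<Rightarrow> nat \<Rightarrow> complex" where
  "scaled_kernel js T r u c v =
     integral {0..T} (\<lambda>t. scaled_jexp js T t r u * cnj (scaled_jexp js T t c v))"

text \<open>This Hermitian symmetry and its analogue for \<open>limit_kernel\<close> reduce the nine
  combinations of signs of the real parts to six.\<close>

lemma scaled_kernel_swap: "scaled_kernel js T c v r u = cnj (scaled_kernel js T r u c v)"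
  unfolding scaled_kernel_def Henstock_Kurzweil_Integration.integral_cnj by (simp add: mult_ac)

lemma continuous_scaled_jexp: "continuous_on S (\<lambda>t. scaled_jexp js T t r c)"
proof -
  have "continuous_on S (\<lambda>t. jexp js (t - T) r c)"
    by (rule continuous_on_compose2[OF continuous_jexp]) (auto intro!: continuous_intros)
  then show ?thesis
    by (cases "Re (eig js r) < 0"; cases "Re (eig js r) = 0")
       (auto simp: scaled_jexp_def divide_inverse intro!: continuous_intros continuous_jexp)
qed

text \<open>The solution of \<open>F K + K F\<^sup>* + E\<^sub>u\<^sub>v = 0\<close> for \<open>F = \<epsilon> J\<close>, where \<open>E\<^sub>u\<^sub>v\<close> is a matrix unit.\<close>

definition lyapunov_kernel :: "complex \<Rightarrow> (nat \<times> complex) list \<Rightarrow> nat \<Rightarrow> nat \<Rightarrow> nat \<Rightarrow> nat \<Rightarrow> complex" where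
  "lyapunov_kernel \<epsilon> js r u c v =
     (if block_no js r = block_no js u \<and> r \<le> u \<and> block_no js c = block_no js v \<and> c \<le> v
      then \<epsilon> ^ ((u - r) + (v - c)) * of_nat (((u - r) + (v - c)) choose (u - r))
         / (- \<epsilon> * (eig js r + cnj (eig js c))) ^ Suc ((u - r) + (v - c)) else 0)"

text \<open>The third branch is an entry of \<open>C_mat\<close>: with
  \<open>height js u = 0\<close>, \<open>u - r\<close> is the distance of row \<open>r\<close> from
  the end of its block, and height 0 singles out the lower-right entry of a block of
  \<open>B\<close>. Equality of eigenvalues rather than of blocks keeps different blocks of one
  eigenvalue coupled.\<close>

definition limit_kernel :: "(nat \<times> complex) list \<Rightarrow> nat \<Rightarrow> nat \<Rightarrow> nat \<Rightarrow> nat \<Rightarrow> complex" where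
  "limit_kernel js r u c v =
     (if Re (eig js r) < 0 \<and> Re (eig js c) < 0 then lyapunov_kernel 1 js r u c v
      else if Re (eig js r) > 0 \<and> Re (eig js c) > 0 then lyapunov_kernel (-1) js r u c v
      else if Re (eig js r) = 0 \<and> eig js r = eig js c \<and>
        block_no js r = block_no js u \<and> r \<le> u \<and> height js u = 0 \<and>
        block_no js c = block_no js v \<and> c \<le> v \<and> height js v = 0
      then 1 / (fact (u - r) * fact (v - c) * of_nat (Suc ((u - r) + (v - c)))) else 0)"

lemma lyapunov_kernel_swap:
  assumes "\<epsilon> \<in> \<real>"
  shows "lyapunov_kernel \<epsilon> js c v r u = cnj (lyapunov_kernel \<epsilon> js r u c v)"
proof -
  have b: "(v - c) + (u - r) choose (v - c) = ((u - r) + (v - c) choose (u - r))"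
    using binomial_symmetric[of "v - c" "(v - c) + (u - r)"] by (simp add: add.commute)
  have e: "cnj \<epsilon> = \<epsilon>" using assms by (simp add: Reals_cnj_iff)
  show ?thesis
    unfolding lyapunov_kernel_def b
    by (simp add: e add.commute[of "v - c"] add.commute[of "cnj (eig js r)"] conj_ac)
qed

lemma limit_kernel_swap: "limit_kernel js c v r u = cnj (limit_kernel js r u c v)"
  unfolding limit_kernel_def lyapunov_kernel_swap[of 1 js c v, simplified]
    lyapunov_kernel_swap[of "-1" js c v, simplified]
  by (auto simp: add.commute mult.commute)

section \<open>Limits of the scaled kernels\<close>

lemma tendsto_power_exp_0_real:
  fixes d :: real
  assumes "0 < d"
  shows "((\<lambda>T. T ^ m * exp (- d * T)) \<longlongrightarrow> 0) at_top"
  using tendsto_Re[OF tendsto_power_exp_0[of "of_real d" m]] assms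
  by (simp add: exp_of_real flip: of_real_mult of_real_power of_real_minus)

lemma integral_real_moment:
  "integral {0..T} (\<lambda>s. s ^ k * exp (- b * s)) = Re (exp_moment k (of_real b) T)"
proof -
  have "(\<lambda>s. s ^ k * exp (- b * s)) integrable_on {0..T}"
    by (intro integrable_continuous_interval continuous_intros)
  moreover have "bounded_linear (of_real :: real \<Rightarrow> complex)" by (rule bounded_linear_of_real)
  ultimately have "integral {0..T} (complex_of_real \<circ> (\<lambda>s. s ^ k * exp (- b * s)))
      = of_real (integral {0..T} (\<lambda>s. s ^ k * exp (- b * s)))" by (rule integral_linear)
  then
  have "exp_moment k (of_real b) T = of_real (integral {0..T} (\<lambda>s. s ^ k * exp (- b * s)))"
    by (simp add: exp_moment_def o_def exp_of_real[symmetric])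
  then show ?thesis by simp
qed

lemma inverse_power_sqrt_tendsto_0: "((\<lambda>T. 1 / (T ^ h * sqrt T)) \<longlongrightarrow> 0) at_top"
proof -
  have "((\<lambda>T. inverse T ^ h * inverse (sqrt T)) \<longlongrightarrow> 0 ^ h * 0) at_top"
    by (intro tendsto_intros tendsto_inverse_0_at_top filterlim_ident sqrt_at_top)
  then show ?thesis by (simp add: field_simps)
qed

section \<open>Kernel limits through exact moments\<close>

context
  fixes js :: "(nat \<times> complex) list" and r c j k :: nat
  assumes bounds: "r + j < size_of js" "c + k < size_of js"
    and blocks: "block_no js r = block_no js (r + j)" "block_no js c = block_no js (c + k)"
begin

private abbreviation (input) "u \<equiv> r + j"
private abbreviation (input) "v \<equiv> c + k"
private abbreviation (input) "a \<equiv> eig js r"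
private abbreviation (input) "b \<equiv> eig js c"
private abbreviation (input) "z \<equiv> - (a + cnj b)"

text \<open>Since \<open>z\<close> is minus the sum of the two exponents, it has positive real part
  for two stable indices, and the moment limits apply to it directly.\<close>

lemma jexp_product:
  "jexp js t r u * cnj (jexp js t c v) =
    1 / (fact j * fact k) * (of_real t ^ (j + k) * exp (- z * of_real t))"
  using blocks by (simp add: jexp_def exp_cnj power_add exp_add ring_distribs mult_ac)

lemma jexp_product_flip:
  "jexp js (- s) r u * cnj (jexp js (- s) c v) =
    (-1) ^ (j + k) / (fact j * fact k) * (of_real s ^ (j + k) * exp (- (- z) * of_real s))"
proof -
  have "(- complex_of_real s) ^ (j + k) = (-1) ^ (j + k) * of_real s ^ (j + k)"
    by (simp add: power_minus[of "complex_of_real s"])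
  then show ?thesis unfolding jexp_product by (simp add: algebra_simps)
qed

lemma fact_binomial: "fact (j + k) / (fact j * fact k) = (of_nat (j + k choose j) :: complex)"
  by (subst binomial_fact) auto

lemma scaled_kernel_lim_stable:
  assumes "Re a < 0" "Re b < 0"
  shows "((\<lambda>T. scaled_kernel js T r u c v) \<longlongrightarrow> limit_kernel js r u c v) at_top"
proof -
  have "((\<lambda>T. 1 / (fact j * fact k) * exp_moment (j + k) z T) \<longlongrightarrow>
      1 / (fact j * fact k) * (fact (j + k) / z ^ Suc (j + k))) at_top"
    using assms by (intro tendsto_intros exp_moment_lim) auto
  also have "1 / (fact j * fact k) * (fact (j + k) / z ^ Suc (j + k)) = limit_kernel js r u c v"
    using assms blocks by (simp add: limit_kernel_def lyapunov_kernel_def add.commute flip: fact_binomial)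
  also have "(\<lambda>T. 1 / (fact j * fact k) * exp_moment (j + k) z T) = (\<lambda>T. scaled_kernel js T r u c v)"
    unfolding scaled_kernel_def exp_moment_def using assms
    by (simp add: scaled_jexp_def jexp_product)
  finally show ?thesis .
qed

text \<open>Substituting \<open>t = T - s\<close> replaces \<open>e^{J(t-T)}\<close> by
  \<open>e^{-Js}\<close> and \<open>z\<close> by \<open>- z\<close>, whose real part is positive.
  The sign \<open>(-1) ^ (j + k)\<close> is the power of \<open>\<epsilon>\<close> in
  \<open>lyapunov_kernel (-1)\<close>.\<close>

lemma scaled_kernel_lim_unstable:
  assumes "Re a > 0" "Re b > 0"
  shows "((\<lambda>T. scaled_kernel js T r u c v) \<longlongrightarrow> limit_kernel js r u c v) at_top"
proof -
  have "((\<lambda>T. (-1) ^ (j + k) / (fact j * fact k) * exp_moment (j + k) (- z) T) \<longlongrightarrow>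
      (-1) ^ (j + k) / (fact j * fact k) * (fact (j + k) / (- z) ^ Suc (j + k))) at_top"
    using assms by (intro tendsto_intros exp_moment_lim) auto
  also have "(-1) ^ (j + k) / (fact j * fact k) * (fact (j + k) / (- z) ^ Suc (j + k))
      = limit_kernel js r u c v"
    using assms blocks by (simp add: limit_kernel_def lyapunov_kernel_def add.commute flip: fact_binomial)
  also have "(\<lambda>T. (-1) ^ (j + k) / (fact j * fact k) * exp_moment (j + k) (- z) T)
      = (\<lambda>T. scaled_kernel js T r u c v)"
  proof
    fix T
    let ?g = "\<lambda>s. jexp js (- s) r u * cnj (jexp js (- s) c v)"
    have "scaled_kernel js T r u c v = integral {0..T} (\<lambda>t. ?g (T - t))"
      using assms by (simp add: scaled_kernel_def scaled_jexp_def)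
    also have "\<dots> = integral {0..T} ?g" by (rule integral_flip)
    finally show "(-1) ^ (j + k) / (fact j * fact k) * exp_moment (j + k) (- z) T = scaled_kernel js T r u c v"
      unfolding jexp_product_flip by (simp add: exp_moment_def)
  qed
  finally show ?thesis .
qed

lemma height_add: "height js r = height js u + j" "height js c = height js v + k"
  using height_diff[OF bounds(1) blocks(1)] height_diff[OF bounds(2) blocks(2)] by simp_all

text \<open>The integral has order at most \<open>T ^ (j + k + 1)\<close>, while the scaling divides
  by \<open>T ^ (height js r + height js c + 1)\<close>. By \<open>height_add\<close> the surplus is
  \<open>T ^ (height js u + height js v)\<close>, which removes every pair of columns except the
  last ones of the two blocks.\<close>

lemma scaled_kernel_lim_imaginary:
  assumes "Re a = 0" "Re b = 0"
  shows "((\<lambda>T. scaled_kernel js T r u c v) \<longlongrightarrow> limit_kernel js r u c v) at_top"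
proof -
  let ?L = "if a = b then 1 / of_nat (Suc (j + k)) else 0 :: complex"
  \<comment> \<open>On the imaginary axis \<open>cnj b = - b\<close>, so
    \<open>z = b - a\<close>.\<close>
  have z0: "z = 0 \<longleftrightarrow> a = b" using assms by (auto simp: complex_eq_iff)
  have lim1: "((\<lambda>T. exp_moment (j + k) z T / of_real T ^ Suc (j + k)) \<longlongrightarrow> ?L) at_top"
  proof (cases "a = b")
    case True
    have "eventually (\<lambda>T. ?L = exp_moment (j + k) z T / of_real T ^ Suc (j + k)) at_top"
      using eventually_gt_at_top[of 0]
    proof eventually_elim
      case (elim T)
      have "z = 0" using True z0 by blast
      then have "exp_moment (j + k) z T = of_real T ^ Suc (j + k) / of_nat (Suc (j + k))"
        using elim exp_moment_0[of T "j + k"] by (simp only: less_imp_le)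
      then show ?case using True elim by simp
    qed
    from Lim_transform_eventually[OF tendsto_const this] show ?thesis .
  next
    case False
    then show ?thesis using exp_moment_oscillating[of z "j + k"] assms z0 by simp
  qed
  have lim: "((\<lambda>T. 1 / (fact j * fact k) * (exp_moment (j + k) z T / of_real T ^ Suc (j + k))
      * inverse (of_real T) ^ (height js u + height js v))
     \<longlongrightarrow> 1 / (fact j * fact k) * ?L * 0 ^ (height js u + height js v)) at_top"
    by (intro tendsto_intros lim1 inverse_of_real_tendsto_0)
  \<comment> \<open>Here \<open>0 ^ 0 = 1\<close> keeps the pair of last columns, and any positive
    height gives 0.\<close>
  have eq: "1 / (fact j * fact k) * ?L * 0 ^ (height js u + height js v) = limit_kernel js r u c v"
    using assms blocks by (auto simp: limit_kernel_def)
  have ev: "eventually (\<lambda>T. 1 / (fact j * fact k) * (exp_moment (j + k) z T / of_real T ^ Suc (j + k))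
      * inverse (of_real T) ^ (height js u + height js v) = scaled_kernel js T r u c v) at_top"
    using eventually_gt_at_top[of 0]
  proof eventually_elim
    case (elim T)
    let ?q = "of_real (T ^ height js r * sqrt T) * of_real (T ^ height js c * sqrt T) :: complex"
    have "scaled_kernel js T r u c v = integral {0..T} (\<lambda>t. (1 / (fact j * fact k) / ?q) *
        (of_real t ^ (j + k) * exp (- z * of_real t)))"
      unfolding scaled_kernel_def
    proof (intro Henstock_Kurzweil_Integration.integral_cong)
      fix t
      have "scaled_jexp js T t r u * cnj (scaled_jexp js T t c v) = jexp js t r u * cnj (jexp js t c v) / ?q"
        using assms by (simp add: scaled_jexp_def)
      then show "scaled_jexp js T t r u * cnj (scaled_jexp js T t c v) = (1 / (fact j * fact k) / ?q) *
        (of_real t ^ (j + k) * exp (- z * of_real t))" unfolding jexp_product by simp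
    qed
    also have "\<dots> = (1 / (fact j * fact k) / ?q) * exp_moment (j + k) z T"
      by (simp only: exp_moment_def Henstock_Kurzweil_Integration.integral_mult_right)
    also have "?q = of_real (T ^ Suc (j + k) * T ^ (height js u + height js v))"
    proof -
      have "T ^ height js r * sqrt T * (T ^ height js c * sqrt T) = T ^ height js r * T ^ height js c * (sqrt T * sqrt T)"
        by (simp only: mult_ac)
      also have "\<dots> = T ^ Suc (j + k) * T ^ (height js u + height js v)"
        using elim unfolding height_add by (simp add: power_add)
      finally show ?thesis by (simp only: of_real_mult[symmetric])
    qed
    finally show ?case by (simp add: divide_inverse power_inverse mult_ac)
  qed
  from Lim_transform_eventually[OF lim ev] show ?thesis unfolding eq .
qed

text \<open>The decay of the stable factor already makes the moment converge, so the normalisation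
  \<open>T^(-h-1/2)\<close> of the imaginary row sends the product to 0.\<close>

lemma scaled_kernel_lim_stable_imaginary:
  assumes "Re a < 0" "Re b = 0"
  shows "((\<lambda>T. scaled_kernel js T r u c v) \<longlongrightarrow> limit_kernel js r u c v) at_top"
proof -
  let ?C = "1 / (fact j * fact k) :: complex"
  have "((\<lambda>T. ?C * exp_moment (j + k) z T * of_real (1 / (T ^ height js c * sqrt T))) \<longlongrightarrow>
      ?C * (fact (j + k) / z ^ Suc (j + k)) * of_real 0) at_top"
    using assms by (intro tendsto_intros exp_moment_lim inverse_power_sqrt_tendsto_0) auto
  also have "?C * (fact (j + k) / z ^ Suc (j + k)) * of_real 0 = limit_kernel js r u c v"
    using assms by (simp add: limit_kernel_def)
  also have "(\<lambda>T. ?C * exp_moment (j + k) z T * of_real (1 / (T ^ height js c * sqrt T)))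
      = (\<lambda>T. scaled_kernel js T r u c v)"
  proof
    fix T
    let ?q = "of_real (1 / (T ^ height js c * sqrt T)) :: complex"
    have "scaled_kernel js T r u c v = integral {0..T} (\<lambda>t. (?C * ?q) *
        (of_real t ^ (j + k) * exp (- z * of_real t)))"
      unfolding scaled_kernel_def
    proof (intro Henstock_Kurzweil_Integration.integral_cong)
      fix t
      have "scaled_jexp js T t r u * cnj (scaled_jexp js T t c v) = jexp js t r u * cnj (jexp js t c v) * ?q"
        using assms by (simp add: scaled_jexp_def)
      then show "scaled_jexp js T t r u * cnj (scaled_jexp js T t c v) = (?C * ?q) *
        (of_real t ^ (j + k) * exp (- z * of_real t))" unfolding jexp_product by (simp only: mult_ac)
    qed
    also have "\<dots> = (?C * ?q) * exp_moment (j + k) z T"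
      by (simp only: exp_moment_def Henstock_Kurzweil_Integration.integral_mult_right)
    finally show "?C * exp_moment (j + k) z T * ?q = scaled_kernel js T r u c v" by (simp only: mult_ac)
  qed
  finally show ?thesis .
qed

end

section \<open>Kernel limits through norm bounds\<close>

lemma norm_jexp:
  assumes "block_no js r = block_no js u" "r \<le> u"
  shows "norm (jexp js t r u) \<le> \<bar>t\<bar> ^ (u - r) * exp (t * Re (eig js r))"
proof -
  have "1 \<le> (fact (u - r) :: real)" by (rule fact_ge_1)
  then have "\<bar>t\<bar> ^ (u - r) * exp (t * Re (eig js r)) / fact (u - r) \<le> \<bar>t\<bar> ^ (u - r) * exp (t * Re (eig js r)) / 1"
    by (intro divide_left_mono) auto
  then show ?thesis using assms
    by (simp add: jexp_def norm_mult norm_divide norm_power norm_exp_eq_Re mult_ac)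
qed

lemma norm_scaled_kernel_le:
  assumes "\<And>t. t \<in> {0..T} \<Longrightarrow> norm (scaled_jexp js T t r u) * norm (scaled_jexp js T t c v) \<le> g t"
    and "g integrable_on {0..T}"
  shows "norm (scaled_kernel js T r u c v) \<le> integral {0..T} g"
proof -
  have "(\<lambda>t. scaled_jexp js T t r u * cnj (scaled_jexp js T t c v)) integrable_on {0..T}"
    by (intro integrable_continuous_interval continuous_intros continuous_scaled_jexp)
  from Henstock_Kurzweil_Integration.integral_norm_bound_integral[OF this assms(2)] assms(1)
  show ?thesis by (simp add: scaled_kernel_def norm_mult)
qed

text \<open>The scaled imaginary factor is at most \<open>1 / sqrt T\<close> on the whole interval,
  while the bound for the unstable one, read backwards from \<open>T\<close>, has a convergent
  integral.\<close>

lemma scaled_kernel_lim_imaginary_unstable: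
  assumes bounds: "u < size_of js" and ru: "block_no js r = block_no js u" "r \<le> u"
    and cv: "block_no js c = block_no js v" "c \<le> v"
    and re: "Re (eig js r) = 0" "Re (eig js c) > 0"
  shows "((\<lambda>T. scaled_kernel js T r u c v) \<longlongrightarrow> limit_kernel js r u c v) at_top"
proof -
  let ?b = "Re (eig js c)" and ?j = "u - r" and ?k = "v - c"
  have "((\<lambda>T. 1 / (T ^ 0 * sqrt T) * Re (exp_moment ?k (of_real ?b) T)) \<longlongrightarrow>
      0 * Re (fact ?k / of_real ?b ^ Suc ?k)) at_top"
    using re by (intro tendsto_intros inverse_power_sqrt_tendsto_0 exp_moment_lim) auto
  then have lim: "((\<lambda>T. 1 / sqrt T * Re (exp_moment ?k (of_real ?b) T)) \<longlongrightarrow> 0) at_top" by simp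
  have "eventually (\<lambda>T. norm (scaled_kernel js T r u c v) \<le> 1 / sqrt T * Re (exp_moment ?k (of_real ?b) T)) at_top"
    using eventually_ge_at_top[of 1]
  proof eventually_elim
    case (elim T)
    let ?g = "\<lambda>s. 1 / sqrt T * (s ^ ?k * exp (- ?b * s))"
    have "norm (scaled_kernel js T r u c v) \<le> integral {0..T} (\<lambda>t. ?g (T - t))"
    proof (rule norm_scaled_kernel_le)
      fix t assume t: "t \<in> {0..T}"
      have "norm (jexp js t r u) \<le> t ^ ?j" using norm_jexp[OF ru, of t] t re by simp
      also have "\<dots> \<le> T ^ ?j" using t by (intro power_mono) auto
      \<comment> \<open>This uses \<open>T \<ge> 1\<close> and
        \<open>height js r = height js u + (u - r)\<close>.\<close>
      also have "\<dots> \<le> T ^ height js r"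
        using elim height_diff[OF bounds ru] by (intro power_increasing) auto
      finally have "norm (jexp js t r u) \<le> T ^ height js r" .
      then have 1: "norm (scaled_jexp js T t r u) \<le> 1 / sqrt T"
        using re elim by (simp add: scaled_jexp_def norm_divide norm_mult norm_power divide_simps)
      have 2: "norm (scaled_jexp js T t c v) \<le> (T - t) ^ ?k * exp (- ?b * (T - t))"
        using norm_jexp[OF cv, of "t - T"] t re by (simp add: scaled_jexp_def algebra_simps)
      show "norm (scaled_jexp js T t r u) * norm (scaled_jexp js T t c v) \<le> ?g (T - t)"
        using 1 2 elim by (intro mult_mono) auto
    qed (intro integrable_continuous_interval continuous_intros)
    also have "\<dots> = integral {0..T} ?g" by (rule integral_flip)
    also have "\<dots> = 1 / sqrt T * Re (exp_moment ?k (of_real ?b) T)"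
      unfolding integral_real_moment[symmetric] Henstock_Kurzweil_Integration.integral_mult_right ..
    finally show ?case .
  qed
  moreover have "eig js r \<noteq> eig js c" using re by auto
  ultimately show ?thesis
    using re Lim_null_comparison[OF _ lim] by (simp add: limit_kernel_def)
qed

text \<open>One factor decays away from 0 and the other away from \<open>T\<close>, so up to a power
  of \<open>T\<close> their product is exponentially small in \<open>T\<close>, uniformly on the
  interval.\<close>

lemma scaled_kernel_lim_stable_unstable:
  assumes ru: "block_no js r = block_no js u" "r \<le> u"
    and cv: "block_no js c = block_no js v" "c \<le> v"
    and re: "Re (eig js r) < 0" "Re (eig js c) > 0"
  shows "((\<lambda>T. scaled_kernel js T r u c v) \<longlongrightarrow> limit_kernel js r u c v) at_top"
proof -
  let ?a = "Re (eig js r)" and ?b = "Re (eig js c)" and ?j = "u - r" and ?k = "v - c"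
  \<comment> \<open>The slower of the two rates, so that \<open>exp (- d * t)\<close> and
    \<open>exp (- d * (T - t))\<close> multiply to a constant in \<open>t\<close>.\<close>
  define d where "d = min (- ?a) ?b"
  have d: "0 < d" "d \<le> - ?a" "d \<le> ?b" using re by (auto simp: d_def)
  have "eventually (\<lambda>T. norm (scaled_kernel js T r u c v) \<le> T ^ Suc (?j + ?k) * exp (- d * T)) at_top"
    using eventually_ge_at_top[of 0]
  proof eventually_elim
    case (elim T)
    have "norm (scaled_kernel js T r u c v) \<le> integral {0..T} (\<lambda>t. T ^ (?j + ?k) * exp (- d * T))"
    proof (rule norm_scaled_kernel_le)
      fix t assume t: "t \<in> {0..T}"
      have "t ^ ?j * exp (t * ?a) \<le> T ^ ?j * exp (- d * t)"
        using t d mult_left_mono[of d "- ?a" t] by (intro mult_mono power_mono) (auto simp: algebra_simps)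
      then have 1: "norm (scaled_jexp js T t r u) \<le> T ^ ?j * exp (- d * t)"
        using norm_jexp[OF ru, of t] t re by (simp add: scaled_jexp_def)
      have "(T - t) ^ ?k * exp ((t - T) * ?b) \<le> T ^ ?k * exp (- d * (T - t))"
        using t d mult_left_mono[of d ?b "T - t"] by (intro mult_mono power_mono) (auto simp: algebra_simps)
      then have 2: "norm (scaled_jexp js T t c v) \<le> T ^ ?k * exp (- d * (T - t))"
        using norm_jexp[OF cv, of "t - T"] t re by (simp add: scaled_jexp_def)
      have "norm (scaled_jexp js T t r u) * norm (scaled_jexp js T t c v)
          \<le> (T ^ ?j * exp (- d * t)) * (T ^ ?k * exp (- d * (T - t)))"
        using 1 2 elim by (intro mult_mono) auto
      also have "\<dots> = T ^ (?j + ?k) * (exp (- d * t) * exp (- d * (T - t)))"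
        by (simp add: power_add)
      also have "exp (- d * t) * exp (- d * (T - t)) = exp (- d * T)"
        unfolding exp_add[symmetric] by (simp add: algebra_simps)
      finally show "norm (scaled_jexp js T t r u) * norm (scaled_jexp js T t c v)
          \<le> T ^ (?j + ?k) * exp (- d * T)" .
    qed (rule integrable_const_ivl)
    also have "\<dots> = T ^ Suc (?j + ?k) * exp (- d * T)" using elim by simp
    finally show ?case .
  qed
  from Lim_null_comparison[OF this tendsto_power_exp_0_real[OF d(1)]] show ?thesis
    using re by (simp add: limit_kernel_def)
qed

lemma scaled_kernel_lim:
  assumes bounds: "u < size_of js" "v < size_of js"
  shows "((\<lambda>T. scaled_kernel js T r u c v) \<longlongrightarrow> limit_kernel js r u c v) at_top"
proof (cases "block_no js r = block_no js u \<and> r \<le> u \<and> block_no js c = block_no js v \<and> c \<le> v")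
  case False
  then have "scaled_kernel js T r u c v = 0" for T
  proof -
    have "scaled_jexp js T t r u * cnj (scaled_jexp js T t c v) = 0" for t
      using False by (auto simp: scaled_jexp_def jexp_def)
    then show ?thesis unfolding scaled_kernel_def by (simp only: integral_0)
  qed
  moreover have "limit_kernel js r u c v = 0"
    using False by (auto simp: limit_kernel_def lyapunov_kernel_def)
  ultimately show ?thesis by simp
next
  case True
  then have ru: "block_no js r = block_no js u" "r \<le> u"
    and cv: "block_no js c = block_no js v" "c \<le> v" by auto
  obtain j k where jk: "u = r + j" "v = c + k" using ru(2) cv(2) le_Suc_ex by blast
  note b = bounds[unfolded jk] and bl = ru(1)[unfolded jk] cv(1)[unfolded jk]
  have swap: "((\<lambda>T. scaled_kernel js T r u c v) \<longlongrightarrow> limit_kernel js r u c v) at_top"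
    if "((\<lambda>T. scaled_kernel js T c v r u) \<longlongrightarrow> limit_kernel js c v r u) at_top"
    using tendsto_cnj[OF that]
    by (simp only: scaled_kernel_swap[of js _ r u c v] limit_kernel_swap[of js r u c v])
  consider "Re (eig js r) < 0" | "Re (eig js r) = 0" | "Re (eig js r) > 0" by linarith
  then show ?thesis
  proof cases
    case 1
    consider "Re (eig js c) < 0" | "Re (eig js c) = 0" | "Re (eig js c) > 0" by linarith
    then show ?thesis
      using scaled_kernel_lim_stable[OF b bl, folded jk] scaled_kernel_lim_stable_imaginary[OF b bl, folded jk]
        scaled_kernel_lim_stable_unstable[OF ru cv] 1 by cases simp_all
  next
    case 2
    consider "Re (eig js c) < 0" | "Re (eig js c) = 0" | "Re (eig js c) > 0" by linarith
    then show ?thesis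
      using swap scaled_kernel_lim_stable_imaginary[OF b(2,1) bl(2,1), folded jk]
        scaled_kernel_lim_imaginary[OF b bl, folded jk]
        scaled_kernel_lim_imaginary_unstable[OF bounds(1) ru cv] 2 by cases simp_all
  next
    case 3
    consider "Re (eig js c) < 0" | "Re (eig js c) = 0" | "Re (eig js c) > 0" by linarith
    then show ?thesis
      using swap scaled_kernel_lim_stable_unstable[OF cv ru]
        scaled_kernel_lim_imaginary_unstable[OF bounds(2) cv ru]
        scaled_kernel_lim_unstable[OF b bl, folded jk] 3 by cases simp_all
  qed
qed

section \<open>Lyapunov equations\<close>

lemma mat_adjoint_dim [simp]:
  "dim_row (mat_adjoint A) = dim_col A" "dim_col (mat_adjoint A) = dim_row A"
  by (simp_all add: mat_adjoint_def)

lemma index_mat_adjoint [simp]: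
  "i < dim_col A \<Longrightarrow> j < dim_row A \<Longrightarrow> mat_adjoint A $$ (i, j) = conjugate (A $$ (j, i))"
  by (simp add: mat_adjoint_def mat_of_rows_index)

text \<open>An entry of the equation couples \<open>W\<close> at \<open>(r, c)\<close> only with its
  lower and right neighbours inside the blocks. The real factor \<open>\<epsilon>\<close> treats
  \<open>J\<close> for the stable part and \<open>- J\<close> for the unstable part at once.\<close>

lemma lyapunov_residual:
  fixes W B :: "complex mat"
  assumes "W \<in> carrier_mat (size_of js) (size_of js)" "B \<in> carrier_mat (size_of js) (size_of js)"
    and "\<epsilon> \<in> \<real>" "r < size_of js" "c < size_of js"
  defines "F \<equiv> \<epsilon> \<cdot>\<^sub>m jordan_matrix js"
  shows "(F * W + W * mat_adjoint F + B) $$ (r, c) = \<epsilon> * ((eig js r + cnj (eig js c)) * W $$ (r, c)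
    + (if Suc r < size_of js \<and> block_no js r = block_no js (Suc r) then W $$ (Suc r, c) else 0)
    + (if Suc c < size_of js \<and> block_no js c = block_no js (Suc c) then W $$ (r, Suc c) else 0))
    + B $$ (r, c)"
proof -
  let ?N = "size_of js"
  have e: "cnj \<epsilon> = \<epsilon>" using assms by (simp add: Reals_cnj_iff)
  have "(F * W) $$ (r, c) = (\<Sum>s<?N. \<epsilon> * jordan_matrix js $$ (r, s) * W $$ (s, c))"
    using assms by (simp add: F_def scalar_prod_def lessThan_atLeast0)
  also have "\<dots> = (\<Sum>s<?N. (if s = r then \<epsilon> * eig js r * W $$ (s, c) else 0)
      + (if s = Suc r then if block_no js r = block_no js s then \<epsilon> * W $$ (s, c) else 0 else 0))"
    using assms by (intro sum.cong) (auto simp: index_jordan_matrix)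
  also have "\<dots> = \<epsilon> * (eig js r * W $$ (r, c) +
      (if Suc r < ?N \<and> block_no js r = block_no js (Suc r) then W $$ (Suc r, c) else 0))"
    using assms by (simp add: sum.distrib algebra_simps)
  finally have 1: "(F * W) $$ (r, c) = \<dots>" .
  have "(W * mat_adjoint F) $$ (r, c) = (\<Sum>s<?N. W $$ (r, s) * cnj (\<epsilon> * jordan_matrix js $$ (c, s)))"
    using assms by (simp add: F_def scalar_prod_def lessThan_atLeast0)
  also have "\<dots> = (\<Sum>s<?N. (if s = c then \<epsilon> * cnj (eig js c) * W $$ (r, s) else 0)
      + (if s = Suc c then if block_no js c = block_no js s then \<epsilon> * W $$ (r, s) else 0 else 0))"
    using assms by (intro sum.cong) (auto simp: index_jordan_matrix e)
  also have "\<dots> = \<epsilon> * (cnj (eig js c) * W $$ (r, c) +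
      (if Suc c < ?N \<and> block_no js c = block_no js (Suc c) then W $$ (r, Suc c) else 0))"
    using assms by (simp add: sum.distrib algebra_simps)
  finally have 2: "(W * mat_adjoint F) $$ (r, c) = \<dots>" .
  have "(F * W + W * mat_adjoint F + B) $$ (r, c) =
      (F * W) $$ (r, c) + (W * mat_adjoint F) $$ (r, c) + B $$ (r, c)"
    using assms by (simp add: F_def)
  then show ?thesis unfolding 1 2 by (simp add: algebra_simps)
qed

text \<open>After clearing powers of \<open>z\<close> this is Pascal's rule for
  \<open>(j + k choose j)\<close>. For \<open>j = k = 0\<close> both neighbours vanish and the
  matrix unit remains.\<close>

lemma lyapunov_kernel_rec:
  fixes \<epsilon> :: complex
  assumes "u < size_of js" "v < size_of js" and nz: "\<epsilon> * (eig js r + cnj (eig js c)) \<noteq> 0"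
  shows "\<epsilon> * ((eig js r + cnj (eig js c)) * lyapunov_kernel \<epsilon> js r u c v
    + (if Suc r < size_of js \<and> block_no js r = block_no js (Suc r) then lyapunov_kernel \<epsilon> js (Suc r) u c v else 0)
    + (if Suc c < size_of js \<and> block_no js c = block_no js (Suc c) then lyapunov_kernel \<epsilon> js r u (Suc c) v else 0))
    = - (if u = r \<and> v = c then 1 else 0)"
proof (cases "block_no js r = block_no js u \<and> r \<le> u \<and> block_no js c = block_no js v \<and> c \<le> v")
  case False
  have zero: "lyapunov_kernel \<epsilon> js r' u c' v = 0"
    if "block_no js r = block_no js r'" "r \<le> r'" "block_no js c = block_no js c'" "c \<le> c'" for r' c'
    unfolding lyapunov_kernel_def using that False by (intro if_not_P) (metis order_trans)
  have "\<not> (u = r \<and> v = c)" using False by auto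
  then show ?thesis by (auto simp: zero)
next
  case True
  then obtain j k where jk: "u = r + j" "v = c + k" using le_Suc_ex by blast
  define z where "z = - \<epsilon> * (eig js r + cnj (eig js c))"
  have z: "z \<noteq> 0" using nz by (simp add: z_def)
  have G: "lyapunov_kernel \<epsilon> js r u c v = \<epsilon> ^ (j + k) * of_nat (j + k choose j) / z ^ Suc (j + k)"
    using True jk by (simp add: lyapunov_kernel_def z_def)
  have r: "(if Suc r < size_of js \<and> block_no js r = block_no js (Suc r) then lyapunov_kernel \<epsilon> js (Suc r) u c v else 0)
    = (if j = 0 then 0 else \<epsilon> ^ (j - 1 + k) * of_nat (j - 1 + k choose (j - 1)) / z ^ Suc (j - 1 + k))"
  proof (cases j)
    case 0
    then show ?thesis using jk by (simp add: lyapunov_kernel_def)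
  next
    case (Suc i)
    then have "block_no js (Suc r) = block_no js r"
      using block_no_between[of r "Suc r" u js] True jk assms by auto
    then show ?thesis using True jk Suc assms eig_cong[of js "Suc r" r]
      by (simp add: lyapunov_kernel_def z_def)
  qed
  have c: "(if Suc c < size_of js \<and> block_no js c = block_no js (Suc c) then lyapunov_kernel \<epsilon> js r u (Suc c) v else 0)
    = (if k = 0 then 0 else \<epsilon> ^ (j + (k - 1)) * of_nat (j + (k - 1) choose j) / z ^ Suc (j + (k - 1)))"
  proof (cases k)
    case 0
    then show ?thesis using jk by (simp add: lyapunov_kernel_def)
  next
    case (Suc i)
    then have "block_no js (Suc c) = block_no js c"
      using block_no_between[of c "Suc c" v js] True jk assms by auto
    then show ?thesis using True jk Suc assms eig_cong[of js "Suc c" c]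
      by (simp add: lyapunov_kernel_def z_def)
  qed
  have e: "\<epsilon> * ((eig js r + cnj (eig js c)) * x + y + w) = \<epsilon> * y + \<epsilon> * w - z * x" for x y w
    by (simp add: z_def algebra_simps)
  have uv: "(u = r \<and> v = c) = (j = 0 \<and> k = 0)" using jk by simp
  show ?thesis unfolding e r c G uv
    using z by (cases j; cases k) (simp_all add: field_simps)
qed

text \<open>Superposing the solutions for matrix units gives existence. Uniqueness, which the
  definite description in \<open>lyapunov_solution\<close> calls for, propagates from the
  lower-right corner: the lower and right neighbours determine an entry because the eigenvalue sum
  is nonzero.\<close>

lemma lyapunov_solution_jordan:
  assumes eps: "\<epsilon> \<in> \<real>" and re: "\<forall>(k, a) \<in> set js. Re (\<epsilon> * a) < 0"
    and B: "B \<in> carrier_mat (size_of js) (size_of js)"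
  shows "lyapunov_solution (\<epsilon> \<cdot>\<^sub>m jordan_matrix js) B = mat (size_of js) (size_of js)
    (\<lambda>(r, c). \<Sum>u<size_of js. \<Sum>v<size_of js. B $$ (u, v) * lyapunov_kernel \<epsilon> js r u c v)" (is "_ = ?W")
proof -
  let ?N = "size_of js" and ?F = "\<epsilon> \<cdot>\<^sub>m jordan_matrix js"
  let ?up = "\<lambda>r. Suc r < ?N \<and> block_no js r = block_no js (Suc r)"
  have nz: "\<epsilon> * (eig js r + cnj (eig js c)) \<noteq> 0" if "r < ?N" "c < ?N" for r c
  proof -
    have "Re (\<epsilon> * eig js r) < 0" "Re (\<epsilon> * eig js c) < 0"
      using eig_mem[OF that(1)] eig_mem[OF that(2)] re by fastforce+
    moreover have "Im \<epsilon> = 0" using eps by (simp add: complex_is_Real_iff)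
    ultimately have "Re (\<epsilon> * (eig js r + cnj (eig js c))) < 0" by (simp add: algebra_simps)
    then show ?thesis by (metis less_irrefl zero_complex.sel(1))
  qed
  have W: "?W \<in> carrier_mat ?N ?N" by simp
  have solves: "?F * ?W + ?W * mat_adjoint ?F + B = 0\<^sub>m ?N ?N"
  proof (rule eq_matI)
    fix r c assume "r < dim_row (0\<^sub>m ?N ?N :: complex mat)" "c < dim_col (0\<^sub>m ?N ?N :: complex mat)"
    then have rc: "r < ?N" "c < ?N" by simp_all
    let ?G = "lyapunov_kernel \<epsilon> js"
    let ?S = "\<lambda>g. \<Sum>u<?N. \<Sum>v<?N. B $$ (u, v) * g u v"
    have W0: "?W $$ (r, c) = ?S (\<lambda>u v. ?G r u c v)" using rc by simp
    have W1: "(if ?up r then ?W $$ (Suc r, c) else 0) = ?S (\<lambda>u v. if ?up r then ?G (Suc r) u c v else 0)"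
      using rc by (cases "?up r") (simp, simp only: if_False mult_zero_right sum.neutral_const)
    have W2: "(if ?up c then ?W $$ (r, Suc c) else 0) = ?S (\<lambda>u v. if ?up c then ?G r u (Suc c) v else 0)"
      using rc by (cases "?up c") (simp, simp only: if_False mult_zero_right sum.neutral_const)
    have S: "\<epsilon> * (x * ?S f + ?S g + ?S h) = ?S (\<lambda>u v. \<epsilon> * (x * f u v + g u v + h u v))" for x f g h
      by (simp add: sum_distrib_left sum.distrib ring_distribs mult_ac)
    have "(?F * ?W + ?W * mat_adjoint ?F + B) $$ (r, c) =
      (\<Sum>u<?N. \<Sum>v<?N. B $$ (u, v) * (\<epsilon> * ((eig js r + cnj (eig js c)) * ?G r u c v
        + (if ?up r then ?G (Suc r) u c v else 0) + (if ?up c then ?G r u (Suc c) v else 0)))) + B $$ (r, c)"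
      unfolding lyapunov_residual[OF W B eps rc] W0 W1 W2 S ..
    also have "\<dots> = (\<Sum>u<?N. \<Sum>v<?N. if v = c then if u = r then - B $$ (u, v) else 0 else 0) + B $$ (r, c)"
    proof (intro arg_cong2[where f = "(+)"] sum.cong refl)
      fix u v assume "u \<in> {..<?N}" "v \<in> {..<?N}"
      then show "B $$ (u, v) * (\<epsilon> * ((eig js r + cnj (eig js c)) * ?G r u c v
        + (if ?up r then ?G (Suc r) u c v else 0) + (if ?up c then ?G r u (Suc c) v else 0)))
        = (if v = c then if u = r then - B $$ (u, v) else 0 else 0)"
        by (subst lyapunov_kernel_rec[OF _ _ nz[OF rc]]) auto
    qed
    also have "\<dots> = 0" using rc by simp
    finally show "(?F * ?W + ?W * mat_adjoint ?F + B) $$ (r, c) = 0\<^sub>m ?N ?N $$ (r, c)" using rc by simp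
  qed (use B in auto)
  show ?thesis unfolding lyapunov_solution_def
  proof (rule the_equality)
    show "?W \<in> carrier_mat (dim_row ?F) (dim_row ?F) \<and>
      ?F * ?W + ?W * mat_adjoint ?F + B = 0\<^sub>m (dim_row ?F) (dim_row ?F)" using solves by simp
  next
    fix V assume "V \<in> carrier_mat (dim_row ?F) (dim_row ?F) \<and>
      ?F * V + V * mat_adjoint ?F + B = 0\<^sub>m (dim_row ?F) (dim_row ?F)"
    then have V: "V \<in> carrier_mat ?N ?N" "?F * V + V * mat_adjoint ?F + B = 0\<^sub>m ?N ?N" by simp_all
    have "V $$ (r, c) = ?W $$ (r, c)" if "r < ?N" "c < ?N" for r c
      using that
    proof (induction "(?N - r) + (?N - c)" arbitrary: r c rule: less_induct)
      case less
      have up: "(if ?up r then V $$ (Suc r, c) else 0) = (if ?up r then ?W $$ (Suc r, c) else 0)"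
        using less by (intro if_cong refl less.hyps) auto
      have right: "(if ?up c then V $$ (r, Suc c) else 0) = (if ?up c then ?W $$ (r, Suc c) else 0)"
        using less by (intro if_cong refl less.hyps) auto
      have cancel: "x * v = x * w \<or> \<epsilon> = 0" if "\<epsilon> * (x * v + p + q) + b = \<epsilon> * (x * w + p + q) + b"
        for x v w p q b using that by auto
      have "(?F * V + V * mat_adjoint ?F + B) $$ (r, c) = (?F * ?W + ?W * mat_adjoint ?F + B) $$ (r, c)"
        unfolding V(2) solves ..
      from cancel[OF this[unfolded lyapunov_residual[OF V(1) B eps less.prems]
          lyapunov_residual[OF W B eps less.prems] up right]]
      have "(eig js r + cnj (eig js c) = 0 \<or> V $$ (r, c) = ?W $$ (r, c)) \<or> \<epsilon> = 0"
        unfolding mult_cancel_left .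
      moreover have "eig js r + cnj (eig js c) \<noteq> 0" "\<epsilon> \<noteq> 0" using nz[OF less.prems] by auto
      ultimately show ?case by blast
    qed
    then show "V = ?W" using V by (intro eq_matI) auto
  qed
qed

lemma lyapunov_kernel_append:
  "r < size_of js \<Longrightarrow> u < size_of js \<Longrightarrow> c < size_of js \<Longrightarrow> v < size_of js \<Longrightarrow>
    lyapunov_kernel \<epsilon> (js @ ks) r u c v = lyapunov_kernel \<epsilon> js r u c v"
  "lyapunov_kernel \<epsilon> (js @ ks) (size_of js + r) (size_of js + u) (size_of js + c) (size_of js + v) =
    lyapunov_kernel \<epsilon> ks r u c v"
  by (simp_all add: lyapunov_kernel_def block_no_append eig_append)

section \<open>Entries of the infinite-horizon Gramian\<close>

lemma sum_lessThan_add: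
  fixes f :: "nat \<Rightarrow> 'a :: comm_monoid_add"
  shows "(\<Sum>i<m + n. f i) = (\<Sum>i<m. f i) + (\<Sum>i<n. f (m + i))"
  by (induction n) (simp_all add: add.assoc)

lemma sum_list_concat: "sum_list (concat xss) = sum_list (map sum_list xss)"
  by (induction xss) auto

lemma nth_concat:
  assumes "l < length xss" "i < length (xss ! l)"
  shows "concat xss ! (sum_list (take l (map length xss)) + i) = xss ! l ! i"
  using assms
proof (induction xss arbitrary: l)
  case (Cons xs xss)
  then show ?case by (cases l) (auto simp: nth_append add.assoc)
qed simp

text \<open>\<open>remdups\<close> keeps last occurrences. In a list sorted by an injective key a
  repeated head equals its successor, so dropping it does not change the head.\<close>

lemma hd_remdups_sorted:
  assumes "sorted (map f xs)" "inj_on f (set xs)" "xs \<noteq> []"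
  shows "hd (remdups xs) = hd xs"
  using assms
proof (induction xs)
  case (Cons x xs)
  show ?case
  proof (cases "x \<in> set xs")
    case True
    then obtain y ys where xs: "xs = y # ys" by (cases xs) auto
    have "f x \<le> f y" "f y \<le> f x" using Cons.prems(1) True xs by auto
    then have "x = y" using Cons.prems(2) xs by (auto dest: inj_onD)
    then show ?thesis using Cons True xs by (auto simp: inj_on_def)
  qed simp
qed simp

text \<open>Such a list consists of runs of equal entries, each recovered from its value and
  multiplicity. For imaginary eigenvalues this matches the multiplicities with runs of consecutive
  Jordan blocks.\<close>

lemma concat_replicate_remdups:
  assumes "sorted (map f xs)" "inj_on f (set xs)"
  shows "concat (map (\<lambda>x. replicate (count_list xs x) x) (remdups xs)) = xs"
  using assms
proof (induction xs)
  case (Cons x xs)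
  then have IH: "concat (map (\<lambda>x. replicate (count_list xs x) x) (remdups xs)) = xs" by simp
  show ?case
  proof (cases "x \<in> set xs")
    case True
    then obtain y ys where rd: "remdups xs = y # ys" by (cases "remdups xs") auto
    then have y: "y = x"
      using hd_remdups_sorted[of f "x # xs"] Cons.prems True by auto
    have nx: "x \<notin> set ys" using distinct_remdups[of xs] rd y by simp
    then have m: "map (\<lambda>z. replicate (count_list (x # xs) z) z) ys = map (\<lambda>z. replicate (count_list xs z) z) ys"
      by (intro map_cong) auto
    have rd': "remdups (x # xs) = x # ys" using True rd y by simp
    show ?thesis unfolding rd' list.map concat.simps m using IH rd y by simp
  next
    case False
    then have m: "map (\<lambda>z. replicate (count_list (x # xs) z) z) (remdups xs) = map (\<lambda>z. replicate (count_list xs z) z) (remdups xs)"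
      by (intro map_cong) auto
    have rd': "remdups (x # xs) = x # remdups xs" using False by simp
    show ?thesis unfolding rd' list.map concat.simps m using IH False by (simp add: count_notin)
  qed
qed simp

lemma concat_upt:
  assumes "\<And>l. \<alpha> l \<le> \<alpha> (Suc l)"
  shows "concat (map (\<lambda>l. [\<alpha> l..<\<alpha> (Suc l)]) [0..<L]) = [\<alpha> 0..<\<alpha> L]"
proof (induction L)
  case (Suc L)
  have "\<alpha> 0 \<le> \<alpha> L" using lift_Suc_mono_le[of \<alpha> 0 L] assms by simp
  moreover obtain d where d: "\<alpha> (Suc L) = \<alpha> L + d" using assms le_Suc_ex by blast
  ultimately have "[\<alpha> 0..<\<alpha> (Suc L)] = [\<alpha> 0..<\<alpha> L] @ [\<alpha> L..<\<alpha> (Suc L)]"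
    unfolding d by (intro upt_add_eq_append)
  then show ?case using Suc by simp
qed simp

lemma block_last:
  assumes "r < size_of js"
  shows "r + height js r < size_of js" "block_no js (r + height js r) = block_no js r"
    "height js (r + height js r) = 0"
    "r + height js r = block_start js (block_no js r) + (fst (js ! block_no js r) - 1)"
proof -
  let ?ks = "map fst js" and ?i = "block_no js r"
  have i: "?i < length js" using assms by (rule block_no_less)
  have r: "sum_list (take ?i ?ks) + snd (locate ?ks r) = r" "snd (locate ?ks r) < fst (js ! ?i)"
    using locate_sum[of r ?ks] snd_locate_less[of r ?ks] assms i by (simp_all add: block_no_def)
  then have e: "r + height js r = sum_list (take ?i ?ks) + (fst (js ! ?i) - 1)"
    by (simp add: height_def)
  then show "r + height js r = block_start js ?i + (fst (js ! ?i) - 1)"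
    by (simp add: block_start_def take_map)
  have "locate ?ks (r + height js r) = (?i, fst (js ! ?i) - 1)"
    unfolding e using i r(2) by (intro locate_eqI) auto
  then show "block_no js (r + height js r) = ?i" by (simp add: block_no_def)
  have "sum_list (take ?i ?ks) + ?ks ! ?i \<le> sum_list ?ks"
  proof -
    have "sum_list (take (Suc ?i) ?ks) + sum_list (drop (Suc ?i) ?ks) = sum_list ?ks"
      unfolding sum_list_append[symmetric] append_take_drop_id ..
    then show ?thesis using i by (simp add: take_Suc_conv_app_nth)
  qed
  then show l: "r + height js r < size_of js" using r(2) i unfolding e by simp
  show "height js (r + height js r) = 0"
    using height_diff[OF l, of r] \<open>block_no js (r + height js r) = ?i\<close> by simp
qed

text \<open>Turns the side condition in \<open>limit_kernel\<close> into equality with a single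
  index, so that the sums over \<open>u\<close> and \<open>v\<close> collapse to one term.\<close>

lemma block_last_iff:
  assumes "r < size_of js" "u < size_of js"
  shows "block_no js r = block_no js u \<and> r \<le> u \<and> height js u = 0 \<longleftrightarrow> u = r + height js r"
  using height_diff[OF assms(2), of r] block_last[OF assms(1)] by auto

lemma index_block_mat:
  "r < sum_list ks \<Longrightarrow> c < sum_list ks \<Longrightarrow> block_mat ks F $$ (r, c) =
    F (fst (locate ks r)) (fst (locate ks c)) $$ (snd (locate ks r), snd (locate ks c))"
  by (simp add: block_mat_def split_beta)

lemma index_sub_block:
  "i < k \<Longrightarrow> j < l \<Longrightarrow> sub_block B r k c l $$ (i, j) = B $$ (r + i, c + j)"
  by (simp add: sub_block_def)

lemma block_no_append_less_iff: "block_no (js @ ks) u < length js \<longleftrightarrow> u < size_of js"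
proof (cases "u < size_of js")
  case True
  then show ?thesis by (simp add: block_no_append block_no_less)
next
  case False
  then obtain u' where "u = size_of js + u'" by (metis le_Suc_ex not_less)
  then show ?thesis by (simp add: block_no_append)
qed

lemma lyapunov_kernel_eq_0:
  assumes "block_no js r \<noteq> block_no js u \<or> block_no js c \<noteq> block_no js v"
  shows "lyapunov_kernel \<epsilon> js r u c v = 0"
  using assms by (auto simp: lyapunov_kernel_def)

section \<open>The diagonal parts of \<open>W_inf\<close> as kernel sums\<close>

context
  fixes Q' :: "complex mat" and Jm J0 Jp js :: "(nat \<times> complex) list"
  assumes js: "js = Jm @ J0 @ Jp"
    and re_neg: "\<forall>(k, a) \<in> set Jm. Re a < 0"
    and re_zero: "\<forall>(k, a) \<in> set J0. Re a = 0"
    and re_pos: "\<forall>(k, a) \<in> set Jp. Re a > 0"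
    and sorted: "sorted (map (\<lambda>(k, a). Im a) J0)"
begin

private abbreviation "N \<equiv> size_of js"
private abbreviation "Nm \<equiv> size_of Jm"
private abbreviation "N0 \<equiv> size_of J0"
private abbreviation "Np \<equiv> size_of Jp"

lemma Re_eig:
  "r < Nm \<Longrightarrow> Re (eig js r) < 0"
  "r < N0 \<Longrightarrow> Re (eig js (Nm + r)) = 0"
  "r < Np \<Longrightarrow> Re (eig js (Nm + N0 + r)) > 0"
proof -
  show "Re (eig js r) < 0" if "r < Nm"
    using eig_mem[OF that] re_neg that by (auto simp: js eig_append)
  show "Re (eig js (Nm + r)) = 0" if "r < N0"
    using eig_mem[OF that] re_zero that by (auto simp: js eig_append)
  show "Re (eig js (Nm + N0 + r)) > 0" if "r < Np"
    using eig_mem[OF that] re_pos that by (auto simp: js eig_append add.assoc)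
qed

lemma W_minus_carrier: "W_minus Q' Jm J0 Jp p \<in> carrier_mat Nm Nm"
  and index_W_minus: "r < Nm \<Longrightarrow> c < Nm \<Longrightarrow> W_minus Q' Jm J0 Jp p $$ (r, c) =
    (\<Sum>u<N. \<Sum>v<N. scaled_input Q' p $$ (u, v) * limit_kernel js r u c v)"
proof -
  let ?B = "scaled_input Q' p"
  let ?S = "sub_block ?B 0 Nm 0 Nm"
  have one: "1 \<cdot>\<^sub>m jordan_matrix Jm = jordan_matrix Jm" by (intro eq_matI) auto
  have re: "\<forall>(k, a)\<in>set Jm. Re (1 * a) < 0" using re_neg by simp
  have S: "?S \<in> carrier_mat Nm Nm" by (simp add: sub_block_def)
  have W: "W_minus Q' Jm J0 Jp p = mat Nm Nm
      (\<lambda>(r, c). \<Sum>u<Nm. \<Sum>v<Nm. ?S $$ (u, v) * lyapunov_kernel 1 Jm r u c v)"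
    using lyapunov_solution_jordan[OF Reals_1 re S] by (simp only: W_minus_def Let_def one)
  then show "W_minus Q' Jm J0 Jp p \<in> carrier_mat Nm Nm" by simp
  assume rc: "r < Nm" "c < Nm"
  \<comment> \<open>No Jordan block straddles two groups, so an index outside the stable range lies
    in another block than \<open>r\<close> and \<open>c\<close>.\<close>
  have out: "limit_kernel js r u c v = 0" if "Nm \<le> u \<or> Nm \<le> v" for u v
  proof -
    have "block_no js r \<noteq> block_no js u \<or> block_no js c \<noteq> block_no js v"
      using that rc block_no_append_less_iff[of Jm "J0 @ Jp"] unfolding js by (metis not_less)
    then show ?thesis using Re_eig(1)[OF rc(1)] Re_eig(1)[OF rc(2)]
      by (simp add: limit_kernel_def lyapunov_kernel_eq_0)
  qed
  have k: "limit_kernel js r u c v = lyapunov_kernel 1 Jm r u c v" if "u < Nm" "v < Nm" for u v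
    using Re_eig(1)[OF rc(1)] Re_eig(1)[OF rc(2)] rc that
    unfolding js by (simp add: limit_kernel_def lyapunov_kernel_append)
  have N: "N = Nm + (N0 + Np)" by (simp add: js)
  have "(\<Sum>u<N. \<Sum>v<N. ?B $$ (u, v) * limit_kernel js r u c v)
      = (\<Sum>u<Nm. \<Sum>v<Nm. ?B $$ (u, v) * limit_kernel js r u c v)"
    unfolding N sum_lessThan_add by (simp add: out)
  also have "\<dots> = (\<Sum>u<Nm. \<Sum>v<Nm. ?S $$ (u, v) * lyapunov_kernel 1 Jm r u c v)"
    by (intro sum.cong refl) (simp add: k index_sub_block)
  finally show "W_minus Q' Jm J0 Jp p $$ (r, c) = (\<Sum>u<N. \<Sum>v<N. ?B $$ (u, v) * limit_kernel js r u c v)"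
    using rc by (simp add: W)
qed

lemma W_plus_carrier: "W_plus Q' Jm J0 Jp p \<in> carrier_mat Np Np"
  and index_W_plus: "r < Np \<Longrightarrow> c < Np \<Longrightarrow> W_plus Q' Jm J0 Jp p $$ (r, c) =
    (\<Sum>u<N. \<Sum>v<N. scaled_input Q' p $$ (u, v) * limit_kernel js (Nm + N0 + r) u (Nm + N0 + c) v)"
proof -
  let ?B = "scaled_input Q' p" and ?o = "Nm + N0"
  let ?S = "sub_block ?B ?o Np ?o Np"
  have neg: "- jordan_matrix Jp = (-1) \<cdot>\<^sub>m jordan_matrix Jp" by (intro eq_matI) auto
  have re: "\<forall>(k, a)\<in>set Jp. Re (- 1 * a) < 0" using re_pos by simp
  have S: "?S \<in> carrier_mat Np Np" by (simp add: sub_block_def)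
  have o: "size_of (Jm @ J0) = ?o" by simp
  have W: "W_plus Q' Jm J0 Jp p = mat Np Np
      (\<lambda>(r, c). \<Sum>u<Np. \<Sum>v<Np. ?S $$ (u, v) * lyapunov_kernel (-1) Jp r u c v)"
    using lyapunov_solution_jordan[OF _ re S] by (simp only: W_plus_def Let_def neg o Reals_minus Reals_1)
  then show "W_plus Q' Jm J0 Jp p \<in> carrier_mat Np Np" by simp
  assume rc: "r < Np" "c < Np"
  have js2: "js = (Jm @ J0) @ Jp" by (simp add: js)
  have out: "limit_kernel js (?o + r) u (?o + c) v = 0" if "u < ?o \<or> v < ?o" for u v
  proof -
    have "block_no js (?o + r) \<noteq> block_no js u \<or> block_no js (?o + c) \<noteq> block_no js v"
      using that rc block_no_append_less_iff[of "Jm @ J0" Jp] unfolding js2 o by (metis not_add_less1)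
    then show ?thesis using Re_eig(3)[OF rc(1)] Re_eig(3)[OF rc(2)]
      by (simp add: limit_kernel_def lyapunov_kernel_eq_0)
  qed
  have k: "limit_kernel js (?o + r) (?o + u) (?o + c) (?o + v) = lyapunov_kernel (-1) Jp r u c v" for u v
    using Re_eig(3)[OF rc(1)] Re_eig(3)[OF rc(2)] lyapunov_kernel_append(2)[of "-1" "Jm @ J0" Jp]
    unfolding js2 o by (simp add: limit_kernel_def)
  have N: "N = ?o + Np" by (simp add: js)
  have "(\<Sum>u<N. \<Sum>v<N. ?B $$ (u, v) * limit_kernel js (?o + r) u (?o + c) v)
      = (\<Sum>u<Np. \<Sum>v<Np. ?B $$ (?o + u, ?o + v) * limit_kernel js (?o + r) (?o + u) (?o + c) (?o + v))"
    unfolding N sum_lessThan_add[of _ ?o Np] by (simp add: out)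
  also have "\<dots> = (\<Sum>u<Np. \<Sum>v<Np. ?S $$ (u, v) * lyapunov_kernel (-1) Jp r u c v)"
    by (intro sum.cong refl) (simp add: k index_sub_block)
  finally show "W_plus Q' Jm J0 Jp p $$ (r, c) =
      (\<Sum>u<N. \<Sum>v<N. ?B $$ (u, v) * limit_kernel js (?o + r) u (?o + c) v)"
    using rc by (simp add: W)
qed

private abbreviation "es \<equiv> imag_eigenvalues J0"
private abbreviation "first_block l \<equiv> length Jm + (\<Sum>l'<l. imag_multiplicity J0 l')"
private abbreviation "part_sizes l \<equiv> map (\<lambda>i. fst (js ! i)) [first_block l..<first_block (Suc l)]"
private abbreviation "kss \<equiv> map part_sizes [0..<length es]"

text \<open>Sorting by imaginary part groups equal eigenvalues, because \<open>Im\<close> is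
  injective where the real part is 0.\<close>

lemma imag_groups:
  "concat (map (\<lambda>l. replicate (imag_multiplicity J0 l) (es ! l)) [0..<length es]) = map snd J0"
proof -
  have "inj_on Im (set (map snd J0))"
  proof (rule inj_onI)
    fix x y assume "x \<in> set (map snd J0)" "y \<in> set (map snd J0)" "Im x = Im y"
    moreover from this have "Re x = 0" "Re y = 0" using re_zero by auto
    ultimately show "x = y" by (simp add: complex_eq_iff)
  qed
  moreover have "sorted (map Im (map snd J0))" using sorted by (simp add: split_def o_def)
  ultimately have "concat (map (\<lambda>x. replicate (count_list (map snd J0) x) x) es) = map snd J0"
    unfolding imag_eigenvalues_def by (intro concat_replicate_remdups)
  moreover have "map (\<lambda>x. replicate (count_list (map snd J0) x) x) es =
      map (\<lambda>l. replicate (imag_multiplicity J0 l) (es ! l)) [0..<length es]"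
    by (intro nth_equalityI) (auto simp: imag_multiplicity_def)
  ultimately show ?thesis by simp
qed

lemma sum_imag_multiplicity: "(\<Sum>l<length es. imag_multiplicity J0 l) = length J0"
  using arg_cong[OF imag_groups, of length]
  by (simp add: length_concat o_def sum_list_sum_nth lessThan_atLeast0)

lemma concat_part_sizes: "concat kss = map fst J0"
proof -
  have "concat kss = map (\<lambda>i. fst (js ! i)) (concat (map (\<lambda>l. [first_block l..<first_block (Suc l)]) [0..<length es]))"
    by (simp add: map_concat o_def)
  also have "\<dots> = map (\<lambda>i. fst (js ! i)) [length Jm..<length Jm + length J0]"
    by (subst concat_upt) (simp_all add: sum_imag_multiplicity)
  also have "\<dots> = map fst J0"
    by (intro nth_equalityI) (auto simp: js nth_append)
  finally show ?thesis .
qed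

lemma sum_part_sizes: "sum_list (map sum_list kss) = N0"
  unfolding sum_list_concat concat_part_sizes[symmetric] ..

lemma take_part_lengths:
  assumes "l \<le> length es"
  shows "sum_list (take l (map length kss)) = (\<Sum>l'<l. imag_multiplicity J0 l')"
  using assms by (simp add: take_map o_def sum_list_sum_nth lessThan_atLeast0)

text \<open>Translates the address of an index within its eigenvalue group into its address in
  \<open>J0\<close>, and identifies the group by the eigenvalue.\<close>

lemma locate_imag:
  assumes "r < N0"
  defines "l \<equiv> fst (locate (map sum_list kss) r)"
    and "q \<equiv> snd (locate (map sum_list kss) r)"
  shows "l < length es" "q < sum_list (part_sizes l)"
    "first_block l + fst (locate (part_sizes l) q) = length Jm + block_no J0 r"
    "snd (locate (part_sizes l) q) = snd (locate (map fst J0) r)"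
    "es ! l = eig J0 r"
proof -
  have r: "r < sum_list (map sum_list kss)" using assms sum_part_sizes by simp
  show l: "l < length es" using fst_locate_less[OF r] by (simp add: l_def)
  show q: "q < sum_list (part_sizes l)" using snd_locate_less[OF r] l unfolding l_def q_def by simp
  have "locate (map fst J0) r = (sum_list (take l (map length kss)) + fst (locate (part_sizes l) q),
      snd (locate (part_sizes l) q))"
    using locate_concat[OF r] l unfolding concat_part_sizes l_def q_def by (simp add: split_beta Let_def)
  then have loc: "locate (map fst J0) r = ((\<Sum>l'<l. imag_multiplicity J0 l') + fst (locate (part_sizes l) q),
      snd (locate (part_sizes l) q))" using take_part_lengths[of l] l by simp
  then show "first_block l + fst (locate (part_sizes l) q) = length Jm + block_no J0 r"
    "snd (locate (part_sizes l) q) = snd (locate (map fst J0) r)" by (simp_all add: block_no_def)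
  let ?xss = "map (\<lambda>l. replicate (imag_multiplicity J0 l) (es ! l)) [0..<length es]"
  let ?i = "fst (locate (part_sizes l) q)"
  have i: "?i < imag_multiplicity J0 l" using fst_locate_less[OF q] by simp
  have "sum_list (take l (map length ?xss)) = (\<Sum>l'<l. imag_multiplicity J0 l')"
    using l by (simp add: take_map o_def sum_list_sum_nth lessThan_atLeast0)
  with nth_concat[of l ?xss ?i] l i
  have "map snd J0 ! ((\<Sum>l'<l. imag_multiplicity J0 l') + ?i) = es ! l"
    unfolding imag_groups by simp
  then show "es ! l = eig J0 r" using loc block_no_less[OF assms(1)] by (simp add: eig_def block_no_def)
qed

lemma W_zero_dims: "map dim_row (map (W_zero_part Q' Jm J0 Jp p) [0..<length es]) = map sum_list kss"
  by (auto simp: W_zero_part_def block_mat_def Let_def js add.assoc intro!: arg_cong[where f = sum_list])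

lemma W_zero_carrier: "W_zero Q' Jm J0 Jp p \<in> carrier_mat N0 N0"
proof -
  have r: "dim_row (W_zero Q' Jm J0 Jp p) = N0"
    unfolding W_zero_def dim_diag_block_mat W_zero_dims sum_part_sizes ..
  have "square_mat (W_zero Q' Jm J0 Jp p)"
    unfolding W_zero_def by (intro diag_block_mat_square) (auto simp: W_zero_part_def block_mat_def Let_def)
  with r show ?thesis by (intro carrier_matI) auto
qed

lemma index_W_zero:
  assumes "r < N0" "c < N0"
  shows "W_zero Q' Jm J0 Jp p $$ (r, c) = (if eig J0 r = eig J0 c
    then scaled_input Q' p $$ (Nm + (r + height J0 r), Nm + (c + height J0 c)) *
      (1 / (fact (height J0 r) * fact (height J0 c) * of_nat (Suc (height J0 r + height J0 c)))) else 0)"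
proof -
  let ?P = "W_zero_part Q' Jm J0 Jp p" and ?B = "scaled_input Q' p"
  define lr where "lr = fst (locate (map sum_list kss) r)"
  define qr where "qr = snd (locate (map sum_list kss) r)"
  define lc where "lc = fst (locate (map sum_list kss) c)"
  define qc where "qc = snd (locate (map sum_list kss) c)"
  note R = locate_imag[OF assms(1), folded lr_def qr_def]
  note C = locate_imag[OF assms(2), folded lc_def qc_def]
  \<comment> \<open>The list of imaginary eigenvalues is distinct, so groups and eigenvalues
    correspond one to one.\<close>
  have same: "lr = lc \<longleftrightarrow> eig J0 r = eig J0 c"
    using R(1,5) C(1,5) nth_eq_iff_index_eq[of es lr lc] by (simp add: imag_eigenvalues_def)
  have sq: "\<forall>B \<in> set (map ?P [0..<length es]). square_mat B"
    by (auto simp: W_zero_part_def block_mat_def Let_def)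
  have "W_zero Q' Jm J0 Jp p $$ (r, c) = (if lr = lc then ?P lr $$ (qr, qc) else 0)"
    unfolding W_zero_def
    using index_diag_block_mat[OF sq, of r c, unfolded W_zero_dims sum_part_sizes, OF assms] R(1) C(1)
    by (simp add: lr_def lc_def qr_def qc_def split_beta Let_def)
  moreover have "?P lr $$ (qr, qc) = ?B $$ (Nm + (r + height J0 r), Nm + (c + height J0 c)) *
      (1 / (fact (height J0 r) * fact (height J0 c) * of_nat (Suc (height J0 r + height J0 c))))" if "lr = lc"
  proof -
    let ?I = "length Jm + block_no J0 r" and ?J = "length Jm + block_no J0 c"
    have part: "?P lr = block_mat (part_sizes lr) (\<lambda>i j. b_entry js ?B (first_block lr + i) (first_block lr + j) \<cdot>\<^sub>m
        map_mat complex_of_real (C_mat (fst (js ! (first_block lr + i))) (fst (js ! (first_block lr + j)))))"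
      by (simp add: W_zero_part_def Let_def js add.assoc)
    have "?P lr $$ (qr, qc) = (b_entry js ?B ?I ?J \<cdot>\<^sub>m
        map_mat complex_of_real (C_mat (fst (js ! ?I)) (fst (js ! ?J)))) $$
        (snd (locate (map fst J0) r), snd (locate (map fst J0) c))"
      unfolding part using R(2) C(2) that
      by (subst index_block_mat) (simp_all only: R(3,4)[unfolded that] C(3,4) that)
    moreover have js_nth: "js ! ?I = J0 ! block_no J0 r" "js ! ?J = J0 ! block_no J0 c"
      using block_no_less[OF assms(1)] block_no_less[OF assms(2)] by (simp_all add: js nth_append)
    have a: "snd (locate (map fst J0) r) < fst (J0 ! block_no J0 r)" "snd (locate (map fst J0) c) < fst (J0 ! block_no J0 c)"
      using snd_locate_less[of r "map fst J0"] snd_locate_less[of c "map fst J0"]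
        block_no_less[OF assms(1)] block_no_less[OF assms(2)] assms by (simp_all add: block_no_def)
    have start: "block_start js ?I = Nm + block_start J0 (block_no J0 r)"
      "block_start js ?J = Nm + block_start J0 (block_no J0 c)"
      using block_no_less[OF assms(1)] block_no_less[OF assms(2)] by (simp_all add: block_start_def js)
    have "b_entry js ?B ?I ?J = ?B $$ (Nm + (r + height J0 r), Nm + (c + height J0 c))"
      unfolding b_entry_def jordan_sub_block_def using a
      by (subst index_sub_block)
        (simp_all add: js_nth start block_last(4)[OF assms(1)] block_last(4)[OF assms(2)] add.assoc)
    ultimately show ?thesis using a
      by (simp add: js_nth C_mat_def height_def)
  qed
  ultimately show ?thesis by (simp add: same)
qed

lemma index_W_zero_kernel:
  assumes "r < N0" "c < N0"
  shows "W_zero Q' Jm J0 Jp p $$ (r, c) =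
    (\<Sum>u<N. \<Sum>v<N. scaled_input Q' p $$ (u, v) * limit_kernel js (Nm + r) u (Nm + c) v)"
proof -
  let ?B = "scaled_input Q' p" and ?R = "Nm + r" and ?C = "Nm + c"
  have rc: "?R < N" "?C < N" using assms by (simp_all add: js)
  have eig: "eig js ?R = eig J0 r" "eig js ?C = eig J0 c"
    using assms by (simp_all add: js eig_append)
  have h: "height js ?R = height J0 r" "height js ?C = height J0 c"
    using assms by (simp_all add: js height_append)
  have k: "limit_kernel js ?R u ?C v = (if v = ?C + height js ?C then if u = ?R + height js ?R then
     (if eig J0 r = eig J0 c then
      1 / (fact (height J0 r) * fact (height J0 c) * of_nat (Suc (height J0 r + height J0 c))) else 0) else 0 else 0)"
    if "u < N" "v < N" for u v
    using Re_eig(2)[OF assms(1)] Re_eig(2)[OF assms(2)] block_last_iff[OF rc(1) that(1)] block_last_iff[OF rc(2) that(2)]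
    by (auto simp: limit_kernel_def eig h)
  have "(\<Sum>u<N. \<Sum>v<N. ?B $$ (u, v) * limit_kernel js ?R u ?C v) =
    (\<Sum>u<N. \<Sum>v<N. if v = ?C + height js ?C then if u = ?R + height js ?R then ?B $$ (u, v) *
     (if eig J0 r = eig J0 c then
      1 / (fact (height J0 r) * fact (height J0 c) * of_nat (Suc (height J0 r + height J0 c))) else 0) else 0 else 0)"
    by (intro sum.cong refl) (simp add: k)
  also have "\<dots> = W_zero Q' Jm J0 Jp p $$ (r, c)"
    using block_last(1)[OF rc(1)] block_last(1)[OF rc(2)]
    unfolding index_W_zero[OF assms] by (simp add: h add.assoc)
  finally show ?thesis ..
qed

lemma W_inf_carrier: "W_inf Q' Jm J0 Jp p \<in> carrier_mat N N"
  using W_minus_carrier[of p] W_zero_carrier[of p] W_plus_carrier[of p]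
  by (intro carrier_matI) (auto simp: W_inf_def dim_diag_block_mat js)

lemma index_W_inf:
  assumes "r < N" "c < N"
  shows "W_inf Q' Jm J0 Jp p $$ (r, c) =
    (\<Sum>u<N. \<Sum>v<N. scaled_input Q' p $$ (u, v) * limit_kernel js r u c v)"
proof -
  let ?Bs = "[W_minus Q' Jm J0 Jp p, W_zero Q' Jm J0 Jp p, W_plus Q' Jm J0 Jp p]"
  note car = W_minus_carrier[of p] W_zero_carrier[of p] W_plus_carrier[of p]
  have sq: "\<forall>B \<in> set ?Bs. square_mat B" using car by auto
  have d: "map dim_row ?Bs = [Nm, N0, Np]" using car by auto
  have N: "sum_list [Nm, N0, Np] = N" by (simp add: js)
  have W: "W_inf Q' Jm J0 Jp p $$ (r, c) = (if fst (locate [Nm, N0, Np] r) = fst (locate [Nm, N0, Np] c)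
      then (?Bs ! fst (locate [Nm, N0, Np] r)) $$ (snd (locate [Nm, N0, Np] r), snd (locate [Nm, N0, Np] c)) else 0)"
    unfolding W_inf_def using index_diag_block_mat[OF sq, of r c, unfolded d N, OF assms]
    by (simp only: split_beta Let_def)
  have region: "(locate [Nm, N0, Np] r = (0, r) \<and> r < Nm) \<or>
     (\<exists>r'<N0. r = Nm + r' \<and> locate [Nm, N0, Np] r = (1, r')) \<or>
     (\<exists>r'<Np. r = Nm + N0 + r' \<and> locate [Nm, N0, Np] r = (2, r'))" if "r < N" for r
  proof -
    consider "r < Nm" | "Nm \<le> r" "r < Nm + N0" | "Nm + N0 \<le> r" by linarith
    then show ?thesis
    proof cases
      case 2
      then obtain r' where "r = Nm + r'" using le_Suc_ex by blast
      with 2 show ?thesis by simp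
    next
      case 3
      then obtain r' where "r = Nm + N0 + r'" using le_Suc_ex by blast
      with that show ?thesis by (simp add: js)
    qed simp
  qed
  \<comment> \<open>Every nonzero branch of \<open>limit_kernel\<close> requires real parts of equal
    sign, which matches the zero blocks between the three groups.\<close>
  have zero: "(\<Sum>u<N. \<Sum>v<N. scaled_input Q' p $$ (u, v) * limit_kernel js r u c v) = 0"
    if "sgn (Re (eig js r)) \<noteq> sgn (Re (eig js c))"
  proof -
    have "limit_kernel js r u c v = 0" for u v
      using that by (auto simp: limit_kernel_def)
    then show ?thesis by simp
  qed
  show ?thesis unfolding W using region[OF assms(1)] region[OF assms(2)]
  proof (elim disjE exE conjE)
  qed (use zero Re_eig in \<open>auto simp: index_W_minus index_W_plus index_W_zero_kernel\<close>)
qed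

end

section \<open>Positive semidefinite matrices\<close>

lemma quadratic_form:
  fixes X :: "'a :: conjugatable_ordered_field mat"
  assumes "X \<in> carrier_mat n n" "v \<in> carrier_vec n"
  shows "(X *\<^sub>v v) \<bullet>c v = (\<Sum>r<n. (\<Sum>c<n. X $$ (r, c) * v $ c) * conjugate (v $ r))"
  using assms by (simp add: scalar_prod_def lessThan_atLeast0)

definition pos_semidefinite :: "'a :: conjugatable_ordered_field mat \<Rightarrow> bool" where
  "pos_semidefinite X \<longleftrightarrow> square_mat X \<and> mat_adjoint X = X \<and>
     (\<forall>v \<in> carrier_vec (dim_row X). 0 \<le> (X *\<^sub>v v) \<bullet>c v)"

lemma pos_definite_det_nonzero:
  assumes "pos_definite X" "X \<in> carrier_mat n n"
  shows "det X \<noteq> 0"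
proof
  assume "det X = 0"
  then obtain v where v: "v \<in> carrier_vec n" "v \<noteq> 0\<^sub>v n" "X *\<^sub>v v = 0\<^sub>v n"
    using det_0_iff_vec_prod_zero[OF assms(2)] by auto
  then have "0 < (X *\<^sub>v v) \<bullet>c v" using assms by (auto simp: pos_definite_def)
  then show False using v by simp
qed

lemma complex_nonneg_iff: "0 \<le> (z :: complex) \<longleftrightarrow> 0 \<le> Re z \<and> Im z = 0"
  by (auto simp: less_eq_complex_def)

text \<open>If \<open>v\<^sup>*Xv = 0\<close>, positivity of the form at \<open>v + sXv\<close> for small negative \<open>s\<close> forces \<open>Xv = 0\<close>.\<close>

lemma pos_semidefinite_kernel:
  fixes X :: "complex mat"
  assumes psd: "pos_semidefinite X" and X: "X \<in> carrier_mat n n" and v: "v \<in> carrier_vec n"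
    and zero: "(X *\<^sub>v v) \<bullet>c v = 0"
  shows "X *\<^sub>v v = 0\<^sub>v n"
proof -
  define w where "w = X *\<^sub>v v"
  have w: "w \<in> carrier_vec n" using X v by (simp add: w_def)
  have herm: "X $$ (r, c) = cnj (X $$ (c, r))" if "r < n" "c < n" for r c
    using psd X that by (metis index_mat_adjoint carrier_matD conjugate_complex_def pos_semidefinite_def)
  have wr: "w $ r = (\<Sum>c<n. X $$ (r, c) * v $ c)" if "r < n" for r
    using that X v by (simp add: w_def scalar_prod_def lessThan_atLeast0)
  define z where "z r = (\<Sum>c<n. X $$ (r, c) * w $ c)" for r
  define N where "N = (\<Sum>r<n. (cmod (w $ r))\<^sup>2)"
  have N: "(\<Sum>r<n. w $ r * cnj (w $ r)) = of_real N"
    by (simp only: N_def of_real_sum complex_norm_square)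
  have v0: "(\<Sum>r<n. w $ r * cnj (v $ r)) = 0"
    using zero unfolding quadratic_form[OF X v] by (simp add: wr)
  have "(\<Sum>r<n. z r * cnj (v $ r)) = (\<Sum>r<n. \<Sum>c<n. w $ c * cnj (X $$ (c, r) * v $ r))"
    unfolding z_def sum_distrib_right
  proof (intro sum.cong refl)
    fix r c assume "r \<in> {..<n}" "c \<in> {..<n}"
    then have e: "X $$ (r, c) = cnj (X $$ (c, r))" by (intro herm) auto
    show "X $$ (r, c) * w $ c * cnj (v $ r) = w $ c * cnj (X $$ (c, r) * v $ r)"
      unfolding e by simp
  qed
  also have "\<dots> = (\<Sum>c<n. w $ c * cnj (w $ c))"
    by (subst sum.swap) (simp add: wr sum_distrib_left)
  finally have zv: "(\<Sum>r<n. z r * cnj (v $ r)) = of_real N" by (simp add: N)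
  define c where "c = (X *\<^sub>v w) \<bullet>c w"
  have zw: "(\<Sum>r<n. z r * cnj (w $ r)) = c"
    unfolding c_def quadratic_form[OF X w] by (simp add: z_def)
  have "0 \<le> c" using psd X w by (auto simp: pos_semidefinite_def c_def)
  then have c: "0 \<le> Re c" by (simp add: complex_nonneg_iff)
  \<comment> \<open>The form at \<open>v + s w\<close> expands to \<open>2 s N + s^2 c\<close>: both
    cross terms equal \<open>N\<close>, and the form at \<open>v\<close> is 0.\<close>
  have pos: "0 \<le> 2 * s * N + s\<^sup>2 * Re c" for s :: real
  proof -
    let ?u = "v + of_real s \<cdot>\<^sub>v w"
    have u: "?u \<in> carrier_vec n" using v w by simp
    have "(X *\<^sub>v ?u) \<bullet>c ?u = (\<Sum>r<n. (w $ r + of_real s * z r) * (cnj (v $ r) + of_real s * cnj (w $ r)))"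
      unfolding quadratic_form[OF X u] using v w
      by (intro sum.cong refl)
        (simp add: wr z_def ring_distribs sum.distrib sum_distrib_left mult_ac)
    also have "\<dots> = (\<Sum>r<n. w $ r * cnj (v $ r)) + of_real s * (\<Sum>r<n. w $ r * cnj (w $ r))
        + of_real s * (\<Sum>r<n. z r * cnj (v $ r)) + (of_real s)\<^sup>2 * (\<Sum>r<n. z r * cnj (w $ r))"
      by (simp add: sum.distrib sum_distrib_left ring_distribs power2_eq_square mult_ac)
    also have "\<dots> = of_real (2 * s * N) + of_real (s\<^sup>2) * c"
      unfolding v0 N zv zw by (simp add: algebra_simps)
    finally have "Re ((X *\<^sub>v ?u) \<bullet>c ?u) = 2 * s * N + s\<^sup>2 * Re c" by simp
    moreover have "0 \<le> (X *\<^sub>v ?u) \<bullet>c ?u" using psd X u by (auto simp: pos_semidefinite_def)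
    ultimately show ?thesis by (simp add: complex_nonneg_iff)
  qed
  have "N \<le> 0"
  proof (cases "Re c = 0")
    case True
    then show ?thesis using pos[of "-1"] by simp
  next
    case False
    then have "0 < Re c" using c by simp
    \<comment> \<open>\<open>s = - N / Re c\<close> minimises the quadratic, with value
      \<open>- N^2 / Re c\<close>.\<close>
    moreover from this have "2 * (- N / Re c) * N + (- N / Re c)\<^sup>2 * Re c = - (N\<^sup>2 / Re c)"
      by (simp add: field_simps power2_eq_square)
    ultimately have "N\<^sup>2 \<le> 0" using pos[of "- N / Re c"] by (simp add: divide_le_0_iff)
    then show ?thesis by simp
  qed
  moreover have "0 \<le> N" by (simp add: N_def sum_nonneg)
  ultimately have "N = 0" by simp
  then have "\<forall>r<n. w $ r = 0" by (simp add: N_def sum_nonneg_eq_0_iff)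
  then show ?thesis using w X by (intro eq_vecI) (auto simp: w_def)
qed

text \<open>Isotropic vectors of a semidefinite matrix lie in its kernel, so a nonzero determinant
  excludes them. Feasibility can thereby be read off a determinant.\<close>

lemma pos_semidefinite_imp_definite:
  fixes X :: "complex mat"
  assumes psd: "pos_semidefinite X" and X: "X \<in> carrier_mat n n" and det: "det X \<noteq> 0"
  shows "pos_definite X"
  unfolding pos_definite_def
proof (intro conjI ballI impI)
  fix v :: "complex vec" assume v: "v \<in> carrier_vec (dim_row X)" "v \<noteq> 0\<^sub>v (dim_row X)"
  then have v': "v \<in> carrier_vec n" "v \<noteq> 0\<^sub>v n" using X by auto
  have "(X *\<^sub>v v) \<bullet>c v \<noteq> 0"
    using pos_semidefinite_kernel[OF psd X v'(1)] det_0_iff_vec_prod_zero[OF X] det v' by auto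
  moreover have "0 \<le> (X *\<^sub>v v) \<bullet>c v" using psd v by (simp add: pos_semidefinite_def)
  ultimately show "0 < (X *\<^sub>v v) \<bullet>c v" by simp
qed (use psd in \<open>simp_all add: pos_semidefinite_def\<close>)

lemma pos_definite_of_real:
  assumes pd: "pos_definite (map_mat complex_of_real G)" and G: "G \<in> carrier_mat n n"
  shows "pos_definite G"
  unfolding pos_definite_def
proof (intro conjI ballI impI)
  let ?C = "map_mat complex_of_real G"
  have C: "?C \<in> carrier_mat n n" using G by simp
  show "square_mat G" using G by simp
  have "complex_of_real (G $$ (i, j)) = complex_of_real (G $$ (j, i))" if "i < n" "j < n" for i j
  proof -
    have "mat_adjoint ?C $$ (i, j) = ?C $$ (i, j)" using pd by (simp add: pos_definite_def)
    then show ?thesis using G that by simp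
  qed
  then show "mat_adjoint G = G" using G by (intro eq_matI) auto
  fix v :: "real vec" assume "v \<in> carrier_vec (dim_row G)" "v \<noteq> 0\<^sub>v (dim_row G)"
  then have v: "v \<in> carrier_vec n" "v \<noteq> 0\<^sub>v n" using G by auto
  let ?v = "map_vec complex_of_real v"
  have v': "?v \<in> carrier_vec n" using v by simp
  have "?v \<noteq> 0\<^sub>v n"
  proof
    assume *: "?v = 0\<^sub>v n"
    have "v $ i = 0" if "i < n" for i
      using arg_cong[OF *, of "\<lambda>u. u $ i"] that v by simp
    then show False using v by auto
  qed
  then have "0 < (?C *\<^sub>v ?v) \<bullet>c ?v" using pd v' C by (auto simp: pos_definite_def)
  also have "(?C *\<^sub>v ?v) \<bullet>c ?v = complex_of_real ((G *\<^sub>v v) \<bullet>c v)"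
    unfolding quadratic_form[OF C v'] quadratic_form[OF G v(1)] using G v by simp
  finally show "0 < (G *\<^sub>v v) \<bullet>c v" by (simp add: less_complex_def)
qed

lemma tendsto_det:
  fixes X :: "'b \<Rightarrow> 'a :: real_normed_field mat"
  assumes "\<And>x. X x \<in> carrier_mat n n" "L \<in> carrier_mat n n"
    and "\<And>r c. r < n \<Longrightarrow> c < n \<Longrightarrow> ((\<lambda>x. X x $$ (r, c)) \<longlongrightarrow> L $$ (r, c)) F"
  shows "((\<lambda>x. det (X x)) \<longlongrightarrow> det L) F"
  unfolding det_def'[OF assms(1)] det_def'[OF assms(2)]
  by (intro tendsto_intros assms(3)) (auto simp: permutes_in_image)

text \<open>The determinant has no zero on the segment from the identity to a positive definite matrix.\<close>

lemma pos_definite_det_pos: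
  fixes G :: "real mat"
  assumes pd: "pos_definite G" and G: "G \<in> carrier_mat n n"
  shows "0 < det G"
proof (rule ccontr)
  assume neg: "\<not> 0 < det G"
  define H where "H s = (1 - s) \<cdot>\<^sub>m 1\<^sub>m n + s \<cdot>\<^sub>m G" for s :: real
  have H: "H s \<in> carrier_mat n n" for s using G by (simp add: H_def)
  have "isCont (\<lambda>s. det (H s)) s" for s
    unfolding isCont_def
  proof (rule tendsto_det[OF H H])
    fix r c assume rc: "r < n" "c < n"
    have "H s $$ (r, c) = (1 - s) * 1\<^sub>m n $$ (r, c) + s * G $$ (r, c)" for s
      using rc G by (simp add: H_def)
    then show "((\<lambda>x. H x $$ (r, c)) \<longlongrightarrow> H s $$ (r, c)) (at s)"
      by (auto intro!: tendsto_intros)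
  qed
  then have "continuous_on {0..1} (\<lambda>s. det (H s))" by (simp add: continuous_at_imp_continuous_on)
  moreover have "H 0 = 1\<^sub>m n" "H 1 = G" using G by (auto simp: H_def intro!: eq_matI)
  ultimately obtain s where s: "0 \<le> s" "s \<le> 1" "det (H s) = 0"
    using IVT2'[of "\<lambda>s. det (H s)" 1 0 0] neg by (auto simp: not_less)
  obtain v where v: "v \<in> carrier_vec n" "v \<noteq> 0\<^sub>v n" "H s *\<^sub>v v = 0\<^sub>v n"
    using s(3) det_0_iff_vec_prod_zero[OF H] by auto
  have g: "0 < (G *\<^sub>v v) \<bullet>c v" using pd v G by (auto simp: pos_definite_def)
  have i: "0 < v \<bullet>c v" using conjugate_square_greater_0_vec[OF v(1)] v(2) by simp
  have "H s *\<^sub>v v = (1 - s) \<cdot>\<^sub>v v + s \<cdot>\<^sub>v (G *\<^sub>v v)"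
  proof -
    have "H s *\<^sub>v v = ((1 - s) \<cdot>\<^sub>m 1\<^sub>m n) *\<^sub>v v + (s \<cdot>\<^sub>m G) *\<^sub>v v"
      unfolding H_def using G v by (intro add_mult_distrib_mat_vec) auto
    moreover have "(a \<cdot>\<^sub>m M) *\<^sub>v v = a \<cdot>\<^sub>v (M *\<^sub>v v)" if "M \<in> carrier_mat n n" for a and M :: "real mat"
      using that v by (intro eq_vecI) (auto simp: scalar_prod_def sum_distrib_left mult.assoc)
    ultimately show ?thesis using G v by simp
  qed
  then have "(H s *\<^sub>v v) \<bullet>c v = (1 - s) * (v \<bullet>c v) + s * ((G *\<^sub>v v) \<bullet>c v)"
    using G v by (simp add: add_scalar_prod_distrib[of _ n])
  also have "\<dots> > 0"
  proof (cases "s = 0")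
    case False
    then have "0 < s * ((G *\<^sub>v v) \<bullet>c v)" using s g by simp
    moreover have "0 \<le> (1 - s) * (v \<bullet>c v)" using s i by simp
    ultimately show ?thesis by simp
  qed (use i in simp)
  finally show False using v by simp
qed

lemma pos_semidefinite_lim:
  fixes X :: "'b \<Rightarrow> complex mat"
  assumes X: "\<And>x. X x \<in> carrier_mat n n" and L: "L \<in> carrier_mat n n" and F: "F \<noteq> bot"
    and lim: "\<And>r c. r < n \<Longrightarrow> c < n \<Longrightarrow> ((\<lambda>x. X x $$ (r, c)) \<longlongrightarrow> L $$ (r, c)) F"
    and psd: "\<And>x. pos_semidefinite (X x)"
  shows "pos_semidefinite L"
  unfolding pos_semidefinite_def
proof (intro conjI ballI)
  show "square_mat L" using L by simp
  have "cnj (L $$ (c, r)) = L $$ (r, c)" if "r < n" "c < n" for r c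
  proof (rule tendsto_unique[OF F _ lim[OF that]])
    have "cnj (X x $$ (c, r)) = X x $$ (r, c)" for x
      using psd[of x] X[of x] that
      by (metis index_mat_adjoint carrier_matD conjugate_complex_def pos_semidefinite_def)
    then show "((\<lambda>x. X x $$ (r, c)) \<longlongrightarrow> cnj (L $$ (c, r))) F"
      using tendsto_cnj[OF lim[OF that(2,1)]] by simp
  qed
  then show "mat_adjoint L = L" using L by (intro eq_matI) auto
  fix v :: "complex vec" assume "v \<in> carrier_vec (dim_row L)"
  then have v: "v \<in> carrier_vec n" using L by simp
  have q: "((\<lambda>x. (X x *\<^sub>v v) \<bullet>c v) \<longlongrightarrow> (L *\<^sub>v v) \<bullet>c v) F"
    unfolding quadratic_form[OF X v] quadratic_form[OF L v]
    by (intro tendsto_intros lim) auto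
  have pos: "0 \<le> (X x *\<^sub>v v) \<bullet>c v" for x
    using psd[of x] X[of x] v by (auto simp: pos_semidefinite_def)
  have "0 \<le> Re ((L *\<^sub>v v) \<bullet>c v)"
    using pos by (intro tendsto_lowerbound[OF tendsto_Re[OF q] _ F]) (simp add: complex_nonneg_iff)
  moreover have "Im ((L *\<^sub>v v) \<bullet>c v) = 0"
    using tendsto_unique[OF F tendsto_Im[OF q], of 0] pos by (simp add: complex_nonneg_iff)
  ultimately show "0 \<le> (L *\<^sub>v v) \<bullet>c v" by (simp add: complex_nonneg_iff)
qed

text \<open>The quadratic form at \<open>v\<close> is the integral of a sum over \<open>l\<close> of
  \<open>p l\<close> times the squared modulus of \<open>\<Sum>r<n. cnj (v $ r) * Y r l t\<close>.
  The factorisation through \<open>Y\<close> covers the Gramian and its scaled version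
  alike.\<close>

lemma pos_semidefinite_integral:
  fixes Y :: "nat \<Rightarrow> nat \<Rightarrow> real \<Rightarrow> complex" and p :: "nat \<Rightarrow> real"
  assumes cont: "\<And>r l. r < n \<Longrightarrow> l < m \<Longrightarrow> continuous_on {0..T} (Y r l)"
    and p: "\<And>l. l < m \<Longrightarrow> 0 \<le> p l"
    and X: "X \<in> carrier_mat n n"
    and entries: "\<And>r c. r < n \<Longrightarrow> c < n \<Longrightarrow>
      X $$ (r, c) = integral {0..T} (\<lambda>t. \<Sum>l<m. of_real (p l) * Y r l t * cnj (Y c l t))"
  shows "pos_semidefinite X"
  unfolding pos_semidefinite_def
proof (intro conjI ballI)
  show "square_mat X" using X by simp
  have "cnj (X $$ (c, r)) = X $$ (r, c)" if "r < n" "c < n" for r c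
    unfolding entries[OF that] entries[OF that(2,1)] Henstock_Kurzweil_Integration.integral_cnj
    by (simp add: mult_ac)
  then show "mat_adjoint X = X" using X by (intro eq_matI) auto
  fix v :: "complex vec" assume "v \<in> carrier_vec (dim_row X)"
  then have v: "v \<in> carrier_vec n" using X by simp
  define g where "g r c t = (\<Sum>l<m. of_real (p l) * Y r l t * cnj (Y c l t))" for r c t
  define h where "h t = (\<Sum>l<m. p l * (cmod (\<Sum>r<n. cnj (v $ r) * Y r l t))\<^sup>2)" for t
  have gi: "g r c integrable_on {0..T}" if "r < n" "c < n" for r c
    unfolding g_def using that by (intro integrable_continuous_interval continuous_intros cont) auto
  have hi: "h integrable_on {0..T}"
    unfolding h_def by (intro integrable_continuous_interval continuous_intros cont) auto
  have "(X *\<^sub>v v) \<bullet>c v = (\<Sum>r<n. \<Sum>c<n. integral {0..T} (\<lambda>t. g r c t * (v $ c * cnj (v $ r))))"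
    unfolding quadratic_form[OF X v] sum_distrib_right
    by (intro sum.cong refl)
      (simp add: entries g_def Henstock_Kurzweil_Integration.integral_mult_left mult_ac)
  also have "\<dots> = (\<Sum>r<n. integral {0..T} (\<lambda>t. \<Sum>c<n. g r c t * (v $ c * cnj (v $ r))))"
    using gi by (intro sum.cong refl Henstock_Kurzweil_Integration.integral_sum[symmetric]
      integrable_on_mult_left) auto
  also have "\<dots> = integral {0..T} (\<lambda>t. \<Sum>r<n. \<Sum>c<n. g r c t * (v $ c * cnj (v $ r)))"
    using gi by (intro Henstock_Kurzweil_Integration.integral_sum[symmetric]
      integrable_sum integrable_on_mult_left) auto
  also have "(\<lambda>t. \<Sum>r<n. \<Sum>c<n. g r c t * (v $ c * cnj (v $ r))) = complex_of_real \<circ> h"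
  proof
    fix t
    have "(\<Sum>r<n. \<Sum>c<n. g r c t * (v $ c * cnj (v $ r))) =
      (\<Sum>r<n. \<Sum>c<n. \<Sum>l<m. of_real (p l) * ((cnj (v $ r) * Y r l t) * cnj (cnj (v $ c) * Y c l t)))"
      by (simp add: g_def sum_distrib_left sum_distrib_right mult_ac)
    also have "\<dots> = (\<Sum>l<m. \<Sum>r<n. \<Sum>c<n. of_real (p l) * ((cnj (v $ r) * Y r l t) * cnj (cnj (v $ c) * Y c l t)))"
      by (subst sum.swap[of _ "{..<m}"])+ (rule refl)
    also have "\<dots> = (\<Sum>l<m. of_real (p l) * ((\<Sum>r<n. cnj (v $ r) * Y r l t) * cnj (\<Sum>c<n. cnj (v $ c) * Y c l t)))"
      unfolding cnj_sum sum_product by (simp only: sum_distrib_left)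
    also have "\<dots> = of_real (h t)" by (simp only: h_def of_real_sum of_real_mult complex_norm_square)
    finally show "(\<Sum>r<n. \<Sum>c<n. g r c t * (v $ c * cnj (v $ r))) = (complex_of_real \<circ> h) t" by simp
  qed
  also have "integral {0..T} (complex_of_real \<circ> h) = of_real (integral {0..T} h)"
    by (rule integral_linear[OF hi bounded_linear_of_real])
  finally show "0 \<le> (X *\<^sub>v v) \<bullet>c v"
    using p hi by (auto simp: complex_nonneg_iff h_def intro!: Henstock_Kurzweil_Integration.integral_nonneg sum_nonneg)
qed

section \<open>The scaled finite-horizon Gramian and its limit\<close>

lemma mat_adjoint_carrier: "P \<in> carrier_mat m n \<Longrightarrow> mat_adjoint P \<in> carrier_mat n m"
  by (intro carrier_matI) auto

lemma index_mult_mat_sum: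
  "A \<in> carrier_mat m n \<Longrightarrow> B \<in> carrier_mat n k \<Longrightarrow> i < m \<Longrightarrow> j < k \<Longrightarrow>
    (A * B) $$ (i, j) = (\<Sum>s<n. A $$ (i, s) * B $$ (s, j))"
  by (simp add: scalar_prod_def lessThan_atLeast0)

lemma sum_rotate:
  "(\<Sum>a\<in>A. \<Sum>b\<in>B. \<Sum>c\<in>C. f a b c) = (\<Sum>b\<in>B. \<Sum>c\<in>C. \<Sum>a\<in>A. f a b c)"
proof -
  have "(\<Sum>a\<in>A. \<Sum>b\<in>B. \<Sum>c\<in>C. f a b c) = (\<Sum>b\<in>B. \<Sum>a\<in>A. \<Sum>c\<in>C. f a b c)" by (rule sum.swap)
  also have "\<dots> = (\<Sum>b\<in>B. \<Sum>c\<in>C. \<Sum>a\<in>A. f a b c)" by (intro sum.cong refl sum.swap)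
  finally show ?thesis .
qed

lemma det_mat_adjoint:
  fixes P :: "complex mat"
  assumes "P \<in> carrier_mat n n"
  shows "det (mat_adjoint P) = cnj (det P)"
proof -
  interpret cnj_hom: comm_ring_hom cnj by unfold_locales auto
  have "mat_adjoint P = transpose_mat (map_mat cnj P)" using assms by (intro eq_matI) auto
  then show ?thesis using det_transpose[of "map_mat cnj P" n] assms by simp
qed

lemma scaled_jexp_mult:
  assumes "r < size_of js" "u < size_of js"
  shows "(\<Sum>s<size_of js. scaled_jexp js T 0 r s * jexp js t s u) = scaled_jexp js T t r u"
  using jexp_add[OF assms, of 0 t] jexp_add[OF assms, of "- T" t]
  by (auto simp: scaled_jexp_def sum_divide_distrib[symmetric])

text \<open>At time 0 the exponential \<open>e^{Jt}\<close> is the identity, so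
  \<open>scaled_jexp\<close> at time 0 has the entries of \<open>D_T\<close>.\<close>

definition scaling_mat :: "(nat \<times> complex) list \<Rightarrow> real \<Rightarrow> complex mat" where
  "scaling_mat js T = mat (size_of js) (size_of js) (\<lambda>(r, c). scaled_jexp js T 0 r c)"

text \<open>Upper triangular, with diagonal entries \<open>1\<close>, \<open>T^(-h-1/2)\<close> or
  \<open>e^{-lambda T}\<close>.\<close>

lemma det_scaling_mat:
  assumes "0 < T"
  shows "det (scaling_mat js T) \<noteq> 0"
proof -
  have "det (scaling_mat js T) = prod_list (diag_mat (scaling_mat js T))"
    by (rule det_upper_triangular[of _ "size_of js"])
      (auto simp: scaling_mat_def scaled_jexp_def jexp_def)
  moreover have "0 \<notin> set (diag_mat (scaling_mat js T))"
    using assms by (auto simp: diag_mat_def scaling_mat_def scaled_jexp_def jexp_def)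
  ultimately show ?thesis by (simp add: prod_list_zero_iff)
qed

text \<open>Bolzano-Weierstrass by successive extraction, one coordinate at a time; the earlier
  coordinates keep converging along each further subsequence.\<close>

lemma coordinatewise_convergent_subseq:
  fixes f :: "nat \<Rightarrow> nat \<Rightarrow> real"
  assumes "\<And>k l. l < n \<Longrightarrow> f k l \<in> {a..b}"
  shows "\<exists>\<rho>. strict_mono \<rho> \<and> (\<forall>l<n. convergent (\<lambda>k. f (\<rho> k) l))"
  using assms
proof (induction n)
  case 0
  then show ?case using strict_mono_id by blast
next
  case (Suc n)
  then obtain \<rho> where \<rho>: "strict_mono \<rho>" "\<forall>l<n. convergent (\<lambda>k. f (\<rho> k) l)" by auto
  have "\<forall>k. f (\<rho> k) n \<in> {a..b}" using Suc.prems by auto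
  then obtain L \<sigma> where \<sigma>: "strict_mono \<sigma>" "((\<lambda>k. f (\<rho> k) n) \<circ> \<sigma>) \<longlonglongrightarrow> L"
    using compact_Icc[of a b] unfolding compact_def by metis
  have "convergent (\<lambda>k. f ((\<rho> \<circ> \<sigma>) k) l)" if "l < Suc n" for l
  proof (cases "l = n")
    case True
    then show ?thesis using \<sigma>(2) by (auto simp: convergent_def o_def)
  next
    case False
    then have "convergent (\<lambda>k. f (\<rho> k) l)" using \<rho>(2) that by simp
    from convergent_subseq_convergent[OF this \<sigma>(1)] show ?thesis by (simp add: o_def)
  qed
  then show ?case using strict_mono_o[OF \<rho>(1) \<sigma>(1)] by blast
qed

context
  fixes A :: "real mat" and n :: nat and Q Q' :: "complex mat" and Jm J0 Jp js :: "(nat \<times> complex) list"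
  assumes A: "A \<in> carrier_mat n n"
    and jd: "jordan_decomposition (map_mat complex_of_real A) Q Q' Jm J0 Jp"
    and js: "js = Jm @ J0 @ Jp"
begin

lemma jordan_similar: "similar_mat_wit (map_mat complex_of_real A) (jordan_matrix js) Q Q'"
  using jd by (simp add: jordan_decomposition_def js)

lemma Q_carrier: "Q \<in> carrier_mat n n" "Q' \<in> carrier_mat n n"
  and Q_inverse: "Q' * Q = 1\<^sub>m n"
  and size_jordan: "size_of js = n"
  using jordan_similar A by (auto simp: similar_mat_wit_def Let_def)

text \<open>The entries of \<open>Q e^{Jt} Q'\<close>, which is the real matrix
  \<open>e^{At}\<close>. Likewise \<open>scaled_flow\<close> holds the entries of
  \<open>D_T e^{Jt} Q'\<close>.\<close>

definition flow :: "nat \<Rightarrow> nat \<Rightarrow> real \<Rightarrow> complex" where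
  "flow i l t = (\<Sum>c<n. \<Sum>r<n. Q $$ (i, r) * jexp js t r c * Q' $$ (c, l))"

definition scaled_flow :: "real \<Rightarrow> nat \<Rightarrow> nat \<Rightarrow> real \<Rightarrow> complex" where
  "scaled_flow T r l t = (\<Sum>u<n. scaled_jexp js T t r u * Q' $$ (u, l))"

lemma of_real_mat_exp: "i < n \<Longrightarrow> l < n \<Longrightarrow> complex_of_real (mat_exp (t \<cdot>\<^sub>m A) $$ (i, l)) = flow i l t"
  unfolding flow_def by (rule mat_exp_jordan[OF A jordan_similar])

lemma continuous_flow: "continuous_on S (flow i l)"
  unfolding flow_def by (intro continuous_intros continuous_jexp)

lemma continuous_scaled_flow: "continuous_on S (scaled_flow T r l)"
  unfolding scaled_flow_def by (intro continuous_intros continuous_scaled_jexp)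

lemma gramian_carrier: "gramian A T p \<in> carrier_mat n n"
  using A by (simp add: gramian_def)

lemma index_gramian:
  assumes "i < n" "j < n"
  shows "complex_of_real (gramian A T p $$ (i, j)) =
    integral {0..T} (\<lambda>t. \<Sum>l<n. of_real (p $ l) * flow i l t * cnj (flow j l t))"
proof -
  define f where "f t = (\<Sum>l<n. p $ l * mat_exp (t \<cdot>\<^sub>m A) $$ (i, l) * mat_exp (t \<cdot>\<^sub>m A) $$ (j, l))" for t
  have E: "mat_exp (t \<cdot>\<^sub>m A) \<in> carrier_mat n n" for t using A by (simp add: mat_exp_def)
  have "(mat_exp (t \<cdot>\<^sub>m A) * mat_diag n (\<lambda>i. p $ i) * mat_exp (t \<cdot>\<^sub>m transpose_mat A)) $$ (i, j) = f t" for t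
    unfolding mat_exp_transpose[OF A] mat_diag_mult_right[OF E] f_def
    using assms carrier_matD[OF E[of t]]
    by (simp add: scalar_prod_def lessThan_atLeast0 mult_ac)
  then have g: "gramian A T p $$ (i, j) = integral {0..T} f"
    using assms A by (simp add: gramian_def)
  have F: "complex_of_real (f t) = (\<Sum>l<n. of_real (p $ l) * flow i l t * cnj (flow j l t))" for t
  proof -
    \<comment> \<open>The entries of \<open>e^{At}\<close> are real, which lets the transpose in the
      Gramian be read as an adjoint.\<close>
    have "cnj (flow j l t) = flow j l t" if "l < n" for l
      using of_real_mat_exp[OF assms(2) that, of t] by (metis complex_cnj_complex_of_real)
    then show ?thesis using assms by (simp add: f_def of_real_mat_exp)
  qed
  have "continuous_on {0..T} (\<lambda>t. Re (complex_of_real (f t)))"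
    unfolding F by (intro continuous_intros continuous_flow)
  then have "f integrable_on {0..T}" by (intro integrable_continuous_interval) simp
  moreover have "bounded_linear complex_of_real" by (rule bounded_linear_of_real)
  ultimately have "integral {0..T} (complex_of_real \<circ> f) = of_real (integral {0..T} f)"
    by (rule integral_linear)
  then have "complex_of_real (integral {0..T} f) = integral {0..T} (\<lambda>t. complex_of_real (f t))"
    by (simp add: o_def)
  then show ?thesis unfolding g F .
qed

definition scaled_gramian :: "real \<Rightarrow> real vec \<Rightarrow> complex mat" where
  "scaled_gramian T p = scaling_mat js T * Q' * map_mat complex_of_real (gramian A T p)
     * mat_adjoint (scaling_mat js T * Q')"

lemma scaling_carrier: "scaling_mat js T \<in> carrier_mat n n"
  by (simp add: scaling_mat_def size_jordan)

lemma scaled_gramian_carrier: "scaled_gramian T p \<in> carrier_mat n n"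
  using scaling_carrier[of T] Q_carrier by (intro carrier_matI) (simp_all add: scaled_gramian_def)

lemma det_scaled_gramian:
  "det (scaled_gramian T p) = of_real ((cmod (det (scaling_mat js T * Q')))\<^sup>2 * det (gramian A T p))"
proof -
  let ?P = "scaling_mat js T * Q'" and ?G = "map_mat complex_of_real (gramian A T p)"
  have P: "?P \<in> carrier_mat n n" using scaling_carrier Q_carrier(2) by (rule mult_carrier_mat)
  have G: "?G \<in> carrier_mat n n" using gramian_carrier by simp
  have adj: "mat_adjoint ?P \<in> carrier_mat n n" using P by (rule mat_adjoint_carrier)
  have "det (scaled_gramian T p) = det ?P * det ?G * det (mat_adjoint ?P)"
    unfolding scaled_gramian_def det_mult[OF mult_carrier_mat[OF P G] adj] det_mult[OF P G] ..
  also have "\<dots> = (det ?P * cnj (det ?P)) * of_real (det (gramian A T p))"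
    unfolding det_mat_adjoint[OF P] of_real_hom.hom_det by (simp only: mult_ac)
  finally show ?thesis by (simp only: of_real_mult complex_norm_square)
qed

lemma scaling_factor_pos:
  assumes "0 < T"
  shows "0 < (cmod (det (scaling_mat js T * Q')))\<^sup>2"
proof -
  have "det Q' * det Q = 1"
    using det_mult[OF Q_carrier(2,1)] Q_inverse by simp
  then have "det Q' \<noteq> 0" by auto
  then show ?thesis
    using det_mult[OF scaling_carrier Q_carrier(2)] det_scaling_mat[OF assms] by simp
qed

text \<open>\<open>D_T Q' e^{At} = D_T Q' Q e^{Jt} Q' = D_T e^{Jt} Q'\<close>.\<close>

lemma scaling_flow:
  assumes "r < n" "l < n"
  shows "(\<Sum>i<n. (scaling_mat js T * Q') $$ (r, i) * flow i l t) = scaled_flow T r l t"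
proof -
  let ?P = "scaling_mat js T * Q'"
  have P: "?P \<in> carrier_mat n n" using scaling_carrier Q_carrier(2) by (rule mult_carrier_mat)
  have PQ: "?P * Q = scaling_mat js T"
    using assoc_mult_mat[OF scaling_carrier Q_carrier(2,1), of T] Q_inverse scaling_carrier[of T] by simp
  have "(\<Sum>i<n. ?P $$ (r, i) * flow i l t) =
      (\<Sum>i<n. \<Sum>c<n. \<Sum>s<n. ?P $$ (r, i) * Q $$ (i, s) * jexp js t s c * Q' $$ (c, l))"
    by (simp add: flow_def sum_distrib_left mult.assoc)
  also have "\<dots> = (\<Sum>c<n. \<Sum>s<n. \<Sum>i<n. ?P $$ (r, i) * Q $$ (i, s) * jexp js t s c * Q' $$ (c, l))"
    by (rule sum_rotate)
  also have "\<dots> = (\<Sum>c<n. \<Sum>s<n. (?P * Q) $$ (r, s) * jexp js t s c * Q' $$ (c, l))"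
    using assms index_mult_mat_sum[OF P Q_carrier(1)]
    by (intro sum.cong refl) (simp only: lessThan_iff sum_distrib_right)
  also have "\<dots> = (\<Sum>c<n. (\<Sum>s<n. scaled_jexp js T 0 r s * jexp js t s c) * Q' $$ (c, l))"
    unfolding PQ using assms by (intro sum.cong refl) (simp add: scaling_mat_def size_jordan sum_distrib_right)
  also have "\<dots> = scaled_flow T r l t"
    unfolding scaled_flow_def using assms scaled_jexp_mult[of r js]
    by (intro sum.cong refl) (simp add: size_jordan)
  finally show ?thesis .
qed

lemma index_scaled_gramian:
  assumes rc: "r < n" "c < n"
  shows "scaled_gramian T p $$ (r, c) =
    integral {0..T} (\<lambda>t. \<Sum>l<n. of_real (p $ l) * scaled_flow T r l t * cnj (scaled_flow T c l t))"
proof -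
  let ?P = "scaling_mat js T * Q'" and ?G = "map_mat complex_of_real (gramian A T p)"
  have P: "?P \<in> carrier_mat n n" using scaling_carrier Q_carrier(2) by (rule mult_carrier_mat)
  have G: "?G \<in> carrier_mat n n" using gramian_carrier by simp
  have adj: "mat_adjoint ?P \<in> carrier_mat n n" using P by (rule mat_adjoint_carrier)
  define g where "g i j t = (\<Sum>l<n. of_real (p $ l) * flow i l t * cnj (flow j l t))" for i j t
  have gi: "g i j integrable_on {0..T}" for i j
    unfolding g_def by (intro integrable_continuous_interval continuous_intros continuous_flow)
  have "scaled_gramian T p $$ (r, c) =
      (\<Sum>j<n. \<Sum>i<n. ?P $$ (r, i) * ?G $$ (i, j) * mat_adjoint ?P $$ (j, c))"
    unfolding scaled_gramian_def by (rule index_mult3_mat[OF P G adj rc])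
  also have "\<dots> = (\<Sum>j<n. \<Sum>i<n. integral {0..T} (\<lambda>t. (?P $$ (r, i) * cnj (?P $$ (c, j))) * g i j t))"
  proof (intro sum.cong refl)
    fix j i assume "j \<in> {..<n}" "i \<in> {..<n}"
    then have ij: "i < n" "j < n" by auto
    have "?G $$ (i, j) = integral {0..T} (g i j)"
      using index_gramian[OF ij] carrier_matD[OF gramian_carrier] ij by (simp add: g_def[abs_def])
    moreover have "mat_adjoint ?P $$ (j, c) = cnj (?P $$ (c, j))"
      using carrier_matD[OF P] ij rc by (subst index_mat_adjoint) (simp_all only: conjugate_complex_def)
    ultimately show "?P $$ (r, i) * ?G $$ (i, j) * mat_adjoint ?P $$ (j, c) =
        integral {0..T} (\<lambda>t. (?P $$ (r, i) * cnj (?P $$ (c, j))) * g i j t)"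
      by (simp only: Henstock_Kurzweil_Integration.integral_mult_right) (simp only: mult_ac)
  qed
  also have "\<dots> = (\<Sum>j<n. integral {0..T} (\<lambda>t. \<Sum>i<n. (?P $$ (r, i) * cnj (?P $$ (c, j))) * g i j t))"
    using gi by (intro sum.cong refl Henstock_Kurzweil_Integration.integral_sum[symmetric]
      integrable_on_mult_right) auto
  also have "\<dots> = integral {0..T} (\<lambda>t. \<Sum>j<n. \<Sum>i<n. (?P $$ (r, i) * cnj (?P $$ (c, j))) * g i j t)"
    using gi by (intro Henstock_Kurzweil_Integration.integral_sum[symmetric]
      integrable_sum integrable_on_mult_right) auto
  also have "(\<lambda>t. \<Sum>j<n. \<Sum>i<n. (?P $$ (r, i) * cnj (?P $$ (c, j))) * g i j t) =
      (\<lambda>t. \<Sum>l<n. of_real (p $ l) * scaled_flow T r l t * cnj (scaled_flow T c l t))"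
  proof
    fix t
    let ?x = "\<lambda>i l. ?P $$ (r, i) * flow i l t" and ?y = "\<lambda>j l. cnj (?P $$ (c, j) * flow j l t)"
    have "(\<Sum>j<n. \<Sum>i<n. (?P $$ (r, i) * cnj (?P $$ (c, j))) * g i j t) =
      (\<Sum>j<n. \<Sum>i<n. \<Sum>l<n. of_real (p $ l) * (?y j l * ?x i l))"
      unfolding g_def sum_distrib_left
      by (intro sum.cong refl) (simp only: complex_cnj_mult mult_ac)
    also have "\<dots> = (\<Sum>l<n. \<Sum>j<n. \<Sum>i<n. of_real (p $ l) * (?y j l * ?x i l))"
      by (rule sum_rotate[symmetric])
    also have "\<dots> = (\<Sum>l<n. of_real (p $ l) * ((\<Sum>j<n. ?y j l) * (\<Sum>i<n. ?x i l)))"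
      unfolding sum_product by (simp only: sum_distrib_left)
    also have "\<dots> = (\<Sum>l<n. of_real (p $ l) * scaled_flow T r l t * cnj (scaled_flow T c l t))"
      unfolding cnj_sum[symmetric]
      by (intro sum.cong refl) (simp add: scaling_flow[OF rc(1)] scaling_flow[OF rc(2)])
    finally show "(\<Sum>j<n. \<Sum>i<n. (?P $$ (r, i) * cnj (?P $$ (c, j))) * g i j t) = \<dots>" .
  qed
  finally show ?thesis .
qed

lemma index_scaled_input:
  assumes "u < n" "v < n"
  shows "scaled_input Q' p $$ (u, v) = (\<Sum>l<n. of_real (p $ l) * (Q' $$ (u, l) * cnj (Q' $$ (v, l))))"
  unfolding scaled_input_def using assms carrier_matD[OF Q_carrier(2)]
  by (subst mat_diag_mult_right[of _ n]) (auto simp: scalar_prod_def lessThan_atLeast0 mult_ac)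

text \<open>Separates the variables: \<open>p\<close> enters only through
  \<open>scaled_input\<close> and \<open>T\<close> only through the kernel.\<close>

lemma index_scaled_gramian_kernel:
  assumes rc: "r < n" "c < n"
  shows "scaled_gramian T p $$ (r, c) =
    (\<Sum>u<n. \<Sum>v<n. scaled_input Q' p $$ (u, v) * scaled_kernel js T r u c v)"
proof -
  define k where "k u v t = scaled_jexp js T t r u * cnj (scaled_jexp js T t c v)" for u v t
  have ki: "k u v integrable_on {0..T}" for u v
    unfolding k_def by (intro integrable_continuous_interval continuous_intros continuous_scaled_jexp)
  have "(\<Sum>l<n. of_real (p $ l) * scaled_flow T r l t * cnj (scaled_flow T c l t)) =
      (\<Sum>u<n. \<Sum>v<n. scaled_input Q' p $$ (u, v) * k u v t)" for t
  proof -
    let ?x = "\<lambda>u l. scaled_jexp js T t r u * Q' $$ (u, l)"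
    let ?y = "\<lambda>v l. cnj (scaled_jexp js T t c v * Q' $$ (v, l))"
    have "(\<Sum>l<n. of_real (p $ l) * scaled_flow T r l t * cnj (scaled_flow T c l t)) =
        (\<Sum>l<n. of_real (p $ l) * ((\<Sum>u<n. ?x u l) * (\<Sum>v<n. ?y v l)))"
      unfolding scaled_flow_def cnj_sum by (simp only: mult.assoc)
    also have "\<dots> = (\<Sum>l<n. \<Sum>u<n. \<Sum>v<n. of_real (p $ l) * (?x u l * ?y v l))"
      unfolding sum_product by (simp only: sum_distrib_left)
    also have "\<dots> = (\<Sum>u<n. \<Sum>v<n. \<Sum>l<n. of_real (p $ l) * (?x u l * ?y v l))"
      by (rule sum_rotate)
    also have "\<dots> = (\<Sum>u<n. \<Sum>v<n. scaled_input Q' p $$ (u, v) * k u v t)"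
    proof (intro sum.cong refl)
      fix u v assume "u \<in> {..<n}" "v \<in> {..<n}"
      then have uv: "u < n" "v < n" by auto
      show "(\<Sum>l<n. of_real (p $ l) * (?x u l * ?y v l)) = scaled_input Q' p $$ (u, v) * k u v t"
        unfolding index_scaled_input[OF uv] k_def sum_distrib_right
        by (intro sum.cong refl) (simp only: complex_cnj_mult mult_ac)
    qed
    finally show ?thesis .
  qed
  then have "scaled_gramian T p $$ (r, c) =
      integral {0..T} (\<lambda>t. \<Sum>u<n. \<Sum>v<n. scaled_input Q' p $$ (u, v) * k u v t)"
    unfolding index_scaled_gramian[OF rc] by simp
  also have "\<dots> = (\<Sum>u<n. integral {0..T} (\<lambda>t. \<Sum>v<n. scaled_input Q' p $$ (u, v) * k u v t))"
    using ki by (intro Henstock_Kurzweil_Integration.integral_sum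
      integrable_sum integrable_on_mult_right) auto
  also have "\<dots> = (\<Sum>u<n. \<Sum>v<n. integral {0..T} (\<lambda>t. scaled_input Q' p $$ (u, v) * k u v t))"
    using ki by (intro sum.cong refl Henstock_Kurzweil_Integration.integral_sum
      integrable_on_mult_right) auto
  finally show ?thesis
    by (simp only: scaled_kernel_def k_def Henstock_Kurzweil_Integration.integral_mult_right)
qed

lemma pos_semidefinite_scaled_gramian:
  assumes "\<And>l. l < n \<Longrightarrow> 0 \<le> p $ l"
  shows "pos_semidefinite (scaled_gramian T p)"
  by (rule pos_semidefinite_integral[of n n T "scaled_flow T" "\<lambda>l. p $ l"])
    (auto intro: continuous_scaled_flow assms scaled_gramian_carrier index_scaled_gramian)

lemma pos_semidefinite_gramian:
  assumes "\<And>l. l < n \<Longrightarrow> 0 \<le> p $ l"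
  shows "pos_semidefinite (map_mat complex_of_real (gramian A T p))"
  by (rule pos_semidefinite_integral[of n n T flow "\<lambda>l. p $ l"])
    (use carrier_matD[OF gramian_carrier] in \<open>auto intro: continuous_flow assms simp: index_gramian\<close>)

lemma W_inf_eq:
  "W_inf Q' Jm J0 Jp p \<in> carrier_mat n n"
  "r < n \<Longrightarrow> c < n \<Longrightarrow> W_inf Q' Jm J0 Jp p $$ (r, c) =
    (\<Sum>u<n. \<Sum>v<n. scaled_input Q' p $$ (u, v) * limit_kernel js r u c v)"
  using W_inf_carrier[OF js] index_W_inf[OF js, of r c Q' p] jd
  by (auto simp: size_jordan jordan_decomposition_def)

text \<open>A finite sum of products of convergent factors, so the horizon and the vector may vary
  together along any filter.\<close>

lemma scaled_gramian_tendsto: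
  assumes "filterlim \<tau> at_top F" and "\<And>l. l < n \<Longrightarrow> ((\<lambda>x. q x $ l) \<longlongrightarrow> q0 $ l) F"
    and rc: "r < n" "c < n"
  shows "((\<lambda>x. scaled_gramian (\<tau> x) (q x) $$ (r, c)) \<longlongrightarrow> W_inf Q' Jm J0 Jp q0 $$ (r, c)) F"
  unfolding index_scaled_gramian_kernel[OF rc] W_inf_eq(2)[OF rc]
proof (intro tendsto_sum tendsto_mult)
  fix u v assume "u \<in> {..<n}" "v \<in> {..<n}"
  then have uv: "u < n" "v < n" by auto
  show "((\<lambda>x. scaled_input Q' (q x) $$ (u, v)) \<longlongrightarrow> scaled_input Q' q0 $$ (u, v)) F"
    unfolding index_scaled_input[OF uv] using assms(2) by (intro tendsto_intros) auto
  show "((\<lambda>x. scaled_kernel js (\<tau> x) r u c v) \<longlongrightarrow> limit_kernel js r u c v) F"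
    using uv by (intro filterlim_compose[OF scaled_kernel_lim assms(1)]) (simp_all add: size_jordan)
qed

lemma det_scaled_gramian_tendsto:
  assumes "filterlim \<tau> at_top F" and "\<And>l. l < n \<Longrightarrow> ((\<lambda>x. q x $ l) \<longlongrightarrow> q0 $ l) F"
  shows "((\<lambda>x. det (scaled_gramian (\<tau> x) (q x))) \<longlongrightarrow> det (W_inf Q' Jm J0 Jp q0)) F"
  using assms by (intro tendsto_det[OF scaled_gramian_carrier W_inf_eq(1)] scaled_gramian_tendsto)

section \<open>Feasibility and optimality of limit points\<close>

lemma pos_definite_gramian:
  assumes "\<And>l. l < n \<Longrightarrow> 0 \<le> p $ l" "det (scaled_gramian T p) \<noteq> 0"
  shows "pos_definite (gramian A T p)"
proof (rule pos_definite_of_real[OF pos_semidefinite_imp_definite gramian_carrier])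
  show "pos_semidefinite (map_mat complex_of_real (gramian A T p))"
    using assms(1) by (rule pos_semidefinite_gramian)
  show "map_mat complex_of_real (gramian A T p) \<in> carrier_mat n n" using gramian_carrier by simp
  show "det (map_mat complex_of_real (gramian A T p)) \<noteq> 0"
    using assms(2) unfolding det_scaled_gramian of_real_hom.hom_det by simp
qed

text \<open>Determinants are compared after scaling, where both sides converge; multiplication by
  the common factor \<open>factor k\<close> preserves the comparison.\<close>

lemma limit_point_optimal:
  fixes \<tau> :: "nat \<Rightarrow> real" and q :: "nat \<Rightarrow> real vec"
  assumes opt: "vcs_solution_inf Q' Jm J0 Jp p_inf"
    and \<tau>: "filterlim \<tau> at_top sequentially" "\<And>k. 0 < \<tau> k"
    and q: "\<And>k. vcs_solution A (\<tau> k) (q k)"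
    and lim: "\<And>l. l < n \<Longrightarrow> (\<lambda>k. q k $ l) \<longlonglongrightarrow> q0 $ l" and q0: "q0 \<in> carrier_vec n"
  shows "vcs_solution_inf Q' Jm J0 Jp q0"
proof -
  let ?W = "W_inf Q' Jm J0 Jp"
  define factor where "factor k = (cmod (det (scaling_mat js (\<tau> k) * Q')))\<^sup>2" for k
  have factor: "0 < factor k" for k unfolding factor_def using \<tau>(2) by (rule scaling_factor_pos)
  have simplex: "q k \<in> prob_simplex n" and pd: "pos_definite (gramian A (\<tau> k) (q k))"
    and best: "\<And>p. p \<in> prob_simplex n \<Longrightarrow> pos_definite (gramian A (\<tau> k) p) \<Longrightarrow>
      \<not> - ln (det (gramian A (\<tau> k) p)) < - ln (det (gramian A (\<tau> k) (q k)))" for k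
    using q[of k] A by (auto simp: vcs_solution_def is_arg_min_def)
  have nonneg: "0 \<le> p $ l" if "p \<in> prob_simplex n" "l < n" for p l
    using that by (simp add: prob_simplex_def)
  have p_inf: "p_inf \<in> prob_simplex n" "pos_definite (?W p_inf)"
    and best_inf: "\<And>p. p \<in> prob_simplex n \<Longrightarrow> pos_definite (?W p) \<Longrightarrow>
      \<not> - ln (Re (det (?W p))) < - ln (Re (det (?W p_inf)))"
    using opt carrier_matD[OF Q_carrier(2)] by (auto simp: vcs_solution_inf_def is_arg_min_def)
  have q0_simplex: "q0 \<in> prob_simplex n"
    unfolding prob_simplex_def
  proof (intro CollectI conjI allI impI)
    show "0 \<le> q0 $ l" if "l < n" for l
      using nonneg[OF simplex that] by (intro LIMSEQ_le_const[OF lim[OF that]]) auto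
    have "(\<lambda>k. \<Sum>l<n. q k $ l) \<longlonglongrightarrow> (\<Sum>l<n. q0 $ l)" by (intro tendsto_sum lim) auto
    moreover have "(\<lambda>k. \<Sum>l<n. q k $ l) = (\<lambda>k. 1)" using simplex by (simp add: prob_simplex_def)
    ultimately show "(\<Sum>l<n. q0 $ l) = 1" by (simp add: LIMSEQ_const_iff)
  qed (rule q0)

  have lim_inf: "(\<lambda>k. det (scaled_gramian (\<tau> k) p_inf)) \<longlonglongrightarrow> det (?W p_inf)"
    by (rule det_scaled_gramian_tendsto[OF \<tau>(1) tendsto_const])
  have lim_q: "(\<lambda>k. det (scaled_gramian (\<tau> k) (q k))) \<longlonglongrightarrow> det (?W q0)"
    by (rule det_scaled_gramian_tendsto[OF \<tau>(1) lim])
  have nz: "det (?W p_inf) \<noteq> 0"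
    using p_inf(2) W_inf_eq(1) by (rule pos_definite_det_nonzero)
  \<comment> \<open>The infinite-horizon optimum becomes a competitor at finite horizon once its
    scaled determinant is nonzero.\<close>
  have ev: "eventually (\<lambda>k. pos_definite (gramian A (\<tau> k) p_inf)) sequentially"
    using tendsto_imp_eventually_ne[OF lim_inf nz]
    by eventually_elim (rule pos_definite_gramian[OF nonneg[OF p_inf(1)]])
  have det_Re: "Re (det (scaled_gramian (\<tau> k) p)) = factor k * det (gramian A (\<tau> k) p)" for k p
    unfolding det_scaled_gramian factor_def by simp
  \<comment> \<open>Positivity of the limit determinant comes from the finite horizons: it is a
    limit of real numbers that are eventually positive, and it is nonzero.\<close>
  have "Im (det (?W p_inf)) = 0"
    using tendsto_Im[OF lim_inf] unfolding det_scaled_gramian by (simp add: LIMSEQ_const_iff)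
  moreover have "0 \<le> Re (det (?W p_inf))"
  proof (rule tendsto_lowerbound[OF tendsto_Re[OF lim_inf]])
    show "eventually (\<lambda>k. 0 \<le> Re (det (scaled_gramian (\<tau> k) p_inf))) sequentially"
      using ev
    proof eventually_elim
      case (elim k)
      then show ?case using pos_definite_det_pos[OF elim gramian_carrier] factor[of k]
        by (simp add: det_Re)
    qed
  qed simp
  ultimately have pos_inf: "0 < Re (det (?W p_inf))"
    using nz by (auto simp: complex_eq_iff less_le)
  have le: "Re (det (?W p_inf)) \<le> Re (det (?W q0))"
  proof (rule tendsto_le[OF _ tendsto_Re[OF lim_q] tendsto_Re[OF lim_inf]])
    show "eventually (\<lambda>k. Re (det (scaled_gramian (\<tau> k) p_inf)) \<le> Re (det (scaled_gramian (\<tau> k) (q k)))) sequentially"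
      using ev
    proof eventually_elim
      case (elim k)
      have "det (gramian A (\<tau> k) p_inf) \<le> det (gramian A (\<tau> k) (q k))"
        using best[OF p_inf(1) elim] pos_definite_det_pos[OF elim gramian_carrier]
          pos_definite_det_pos[OF pd gramian_carrier, of k] by simp
      then show ?case using factor[of k] by (simp add: det_Re)
    qed
  qed simp
  have psd: "pos_semidefinite (?W q0)"
    by (rule pos_semidefinite_lim[OF scaled_gramian_carrier W_inf_eq(1) sequentially_bot
          scaled_gramian_tendsto[OF \<tau>(1) lim] pos_semidefinite_scaled_gramian[OF nonneg[OF simplex]]])
  \<comment> \<open>The comparison bounds this determinant below by a positive number, so the limit
    point cannot degenerate.\<close>
  have "det (?W q0) \<noteq> 0" using le pos_inf by auto
  then have pd0: "pos_definite (?W q0)" by (rule pos_semidefinite_imp_definite[OF psd W_inf_eq(1)])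
  have "\<not> - ln (Re (det (?W p))) < - ln (Re (det (?W q0)))"
    if "p \<in> prob_simplex n" "pos_definite (?W p)" for p
  proof -
    have "ln (Re (det (?W p_inf))) \<le> ln (Re (det (?W q0)))" using le pos_inf by simp
    then show ?thesis using best_inf[OF that] by simp
  qed
  then show ?thesis using q0_simplex pd0 carrier_matD[OF Q_carrier(2)]
    by (auto simp: vcs_solution_inf_def is_arg_min_def)
qed

end

section \<open>Convergence from compactness and uniqueness\<close>

theorem theorem2:
  fixes A :: "real mat" and n :: nat
    and Q Q' :: "complex mat"
    and Jm J0 Jp :: "(nat \<times> complex) list"
    and p_inf :: "real vec" and p_T :: "real \<Rightarrow> real vec"
  assumes "A \<in> carrier_mat n n"
    and "jordan_decomposition (map_mat complex_of_real A) Q Q' Jm J0 Jp"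
    and "vcs_solution_inf Q' Jm J0 Jp p_inf"
    and "\<And>q. vcs_solution_inf Q' Jm J0 Jp q \<Longrightarrow> q = p_inf"
    and "\<And>T. T > 0 \<Longrightarrow> vcs_solution A T (p_T T)"
  shows "\<forall>i<n. ((\<lambda>T. p_T T $ i) \<longlongrightarrow> p_inf $ i) at_top"
proof (intro allI impI, rule ccontr)
  fix i assume i: "i < n" and "\<not> ((\<lambda>T. p_T T $ i) \<longlongrightarrow> p_inf $ i) at_top"
  then obtain e where e: "0 < e" "\<not> eventually (\<lambda>T. dist (p_T T $ i) (p_inf $ i) < e) at_top"
    unfolding tendsto_iff by blast
  \<comment> \<open>Failure of convergence yields bad horizons beyond every bound; the bound
    \<open>Suc k\<close> makes them positive as well as unbounded.\<close>
  have "\<forall>k. \<exists>T. T \<ge> real (Suc k) \<and> e \<le> dist (p_T T $ i) (p_inf $ i)"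
    using e(2) unfolding eventually_at_top_linorder by (meson not_less)
  then obtain \<tau> where \<tau>: "\<And>k. \<tau> k \<ge> real (Suc k)" "\<And>k. e \<le> dist (p_T (\<tau> k) $ i) (p_inf $ i)"
    by metis
  have pos: "0 < \<tau> k" for k using \<tau>(1)[of k] by simp
  have simplex: "p_T (\<tau> k) \<in> prob_simplex n" for k
    using assms(5)[OF pos[of k]] assms(1) by (auto simp: vcs_solution_def is_arg_min_def)
  have "p_T (\<tau> k) $ l \<in> {0..1}" if "l < n" for k l
  proof -
    have "p_T (\<tau> k) $ l \<le> (\<Sum>j<n. p_T (\<tau> k) $ j)"
      using simplex[of k] that by (intro member_le_sum) (auto simp: prob_simplex_def)
    then show ?thesis using simplex[of k] that by (simp add: prob_simplex_def)
  qed
  from coordinatewise_convergent_subseq[of n "\<lambda>k l. p_T (\<tau> k) $ l", OF this]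
  obtain \<rho> where \<rho>: "strict_mono \<rho>" "\<And>l. l < n \<Longrightarrow> convergent (\<lambda>k. p_T (\<tau> (\<rho> k)) $ l)" by auto
  define q0 where "q0 = vec n (\<lambda>l. lim (\<lambda>k. p_T (\<tau> (\<rho> k)) $ l))"
  have lim: "(\<lambda>k. p_T (\<tau> (\<rho> k)) $ l) \<longlonglongrightarrow> q0 $ l" if "l < n" for l
    using \<rho>(2)[OF that] that by (simp add: q0_def convergent_LIMSEQ_iff)
  have "filterlim (\<lambda>k. \<tau> (\<rho> k)) at_top sequentially"
  proof (rule filterlim_at_top_mono[OF filterlim_real_sequentially])
    have "real k \<le> \<tau> (\<rho> k)" for k
      using \<tau>(1)[of "\<rho> k"] seq_suble[OF \<rho>(1), of k] by simp
    then show "eventually (\<lambda>k. real k \<le> \<tau> (\<rho> k)) sequentially" by simp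
  qed
  then have "vcs_solution_inf Q' Jm J0 Jp q0"
    using assms(5) pos lim
    by (intro limit_point_optimal[OF assms(1,2) refl assms(3)]) (auto simp: q0_def)
  \<comment> \<open>Uniqueness identifies the limit of the subsequence, against the distance
    \<open>e\<close> kept along all of \<open>\<tau>\<close> in coordinate \<open>i\<close>.\<close>
  then have "q0 = p_inf" by (rule assms(4))
  then have "eventually (\<lambda>k. dist (p_T (\<tau> (\<rho> k)) $ i) (p_inf $ i) < e) sequentially"
    using lim[OF i] e(1) by (simp add: tendsto_iff)
  then obtain k where "dist (p_T (\<tau> (\<rho> k)) $ i) (p_inf $ i) < e"
    unfolding eventually_sequentially by blast
  with \<tau>(2)[of "\<rho> k"] show False by simp
qed

end
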